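(* Let $\Omega\subseteq\mathbb H$ be open and let $f\in\mathcal{SR}_{loc}(\Omega)\setminus\mathcal{SC}_{loc}(\Omega)$. Then: (1) $f$ is quasi-open. (2) The restriction $f|_{\Omega\setminus(D_f\cup W_f)}$ is open.
   Context: $\mathbb H$ is the skew field of quaternions, $x=x_0+ix_1+jx_2+kx_3$, $\mathbb S_{\mathbb H}$ the sphere of imaginary units, $\mathbb C_I=\mathrm{span}(1,I)$ for $I\in\mathbb S_{\mathbb H}$, $\mathrm{Im}(x)=\frac{x-\overline x}2$, $\mathbb S_x=\alpha+\beta\,\mathbb S_{\mathbb H}$ if $x=\alpha+\beta I$, and $\overline\partial=\frac12(\partial_0+i\partial_1+j\partial_2+k\partial_3)$. $\mathcal{SR}_{loc}(\Omega)$ (locally slice-regular functions) is the set of $\mathcal C^1$ functions $f:\Omega\to\mathbb H$ such that (i) for every $I\in\mathbb S_{\mathbb H}$ with $\Omega\cap\mathbb C_I\ne\emptyset$, $f|_{\Omega\cap\mathbb C_I}$ is holomorphic w.r.t. the complex structures given by left multiplication by $I$, and (ii) $\overline\partial f$ and $\overline\partial(xf)$ are locally constant on $\mathbb S_y\cap\Omega$ for every $y\in\Omega$. $\mathcal{SC}_{loc}(\Omega)$ is the set of $f\in\mathcal{SR}_{loc}(\Omega)$ with $\vartheta f=0$ on $\Omega\setminus\mathbb R$, where $\vartheta=\frac12\big(\partial_0-\frac{\mathrm{Im}(x)}{|\mathrm{Im}(x)|^2}\sum_{i=1}^3x_i\partial_i\big)$. The degenerate set of $f$ is $D_f=\{x\in\Omega:\overline\partial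 f(x)=0\}$. A continuous map $g:X\to Y$ of topological spaces is quasi-open if for each $y\in g(X)$ and each open $U\subseteq X$ containing a compact connected component of $g^{-1}(y)$, $y$ is in the interior of $g(U)$. Slice-regular functions: for $D\subseteq\mathbb C$ open and conjugation-invariant, $\Omega_D=\{\alpha+J\beta:\alpha+i\beta\in D,\ J\in\mathbb S_{\mathbb H}\}$; a stem function is $F=F_1+\imath F_2:D\to\mathbb H\otimes_{\mathbb R}\mathbb C$ ($\imath^2=-1$) with $F(\overline z)=\overline{F(z)}$, where $\overline{a+\imath b}=a-\imath b$; $g=\mathcal I(F):\Omega_D\to\mathbb H$, $g(\alpha+J\beta)=F_1+JF_2$ at $\alpha+i\beta$, is slice-regular if $F$ is holomorphic w.r.t. $\imath$. The normal function of $g$ is $N(g)=\mathcal I(FF^c)$, where $F^c=\overline{F_1}+\imath\,\overline{F_2}$ (quaternionic conjugates of $F_1,F_2$). Wings: each $y\in\Omega$ has a connected open neighbourhood $\Omega_y\subseteq\Omega$ such that $f|_{\Omega_y}$ extends to a slice-regular $g_y$ on $\widetilde{\Omega_y}=\bigcup_{x\in\Omega_y}\mathbb S_x$. For a slice-regular function $g$ on an axially symmetric domain $G$ with degenerate set $D_g=\{x\in G:\overline\partial g(x)=0\}$, and $c\in\mathbb H$ with $N(g-c)\equiv0$, the wing $W_{g,c}$ is the closure in $G$ of $g^{-1}(c)\setminus D_g$ (when non-empty, a real analytic surface contained in the fibre $g^{-1}(c)$). $W_g$ is the union of all wings $W_{g,c}$ of $g$ over the $c\in\mathbb H$ with $N(g-c)\equiv0$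 (so $W_g=\emptyset$ if $G\cap\mathbb R\neq\emptyset$), and $W_f=\bigcup_{y\in\Omega}(W_{g_y}\cap\Omega_y)$. *)

theory Defs
  imports "HOL-Analysis.Analysis"
begin

section \<open>Quaternions\<close>

datatype quat = Quat (q0: real) (q1: real) (q2: real) (q3: real)

lemma quat_eq_iff: "x = y \<longleftrightarrow> q0 x = q0 y \<and> q1 x = q1 y \<and> q2 x = q2 y \<and> q3 x = q3 y"
  using quat.expand by blast

instantiation quat :: ring_1
begin

definition "0 = Quat 0 0 0 0"
definition "1 = Quat 1 0 0 0"
definition "x + y = Quat (q0 x + q0 y) (q1 x + q1 y) (q2 x + q2 y) (q3 x + q3 y)"
definition "- x = Quat (- q0 x) (- q1 x) (- q2 x) (- q3 x)"
definition "x - y = Quat (q0 x - q0 y) (q1 x - q1 y) (q2 x - q2 y) (q3 x - q3 y)"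
definition "x * y = Quat
  (q0 x * q0 y - q1 x * q1 y - q2 x * q2 y - q3 x * q3 y)
  (q0 x * q1 y + q1 x * q0 y + q2 x * q3 y - q3 x * q2 y)
  (q0 x * q2 y - q1 x * q3 y + q2 x * q0 y + q3 x * q1 y)
  (q0 x * q3 y + q1 x * q2 y - q2 x * q1 y + q3 x * q0 y)"

instance
  by standard
    (simp_all add: quat_eq_iff zero_quat_def one_quat_def plus_quat_def uminus_quat_def
      minus_quat_def times_quat_def algebra_simps)

end

lemma quat_sel [simp]:
  "q0 0 = 0" "q1 0 = 0" "q2 0 = 0" "q3 0 = 0"
  "q0 1 = 1" "q1 1 = 0" "q2 1 = 0" "q3 1 = 0"
  "q0 (x + y) = q0 x + q0 y" "q1 (x + y) = q1 x + q1 y"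
  "q2 (x + y) = q2 x + q2 y" "q3 (x + y) = q3 x + q3 y"
  "q0 (- x) = - q0 x" "q1 (- x) = - q1 x" "q2 (- x) = - q2 x" "q3 (- x) = - q3 x"
  "q0 (x - y) = q0 x - q0 y" "q1 (x - y) = q1 x - q1 y"
  "q2 (x - y) = q2 x - q2 y" "q3 (x - y) = q3 x - q3 y"
  "q0 (x * y) = q0 x * q0 y - q1 x * q1 y - q2 x * q2 y - q3 x * q3 y"
  "q1 (x * y) = q0 x * q1 y + q1 x * q0 y + q2 x * q3 y - q3 x * q2 y"
  "q2 (x * y) = q0 x * q2 y - q1 x * q3 y + q2 x * q0 y + q3 x * q1 y"
  "q3 (x * y) = q0 x * q3 y + q1 x * q2 y - q2 x * q1 y + q3 x * q0 y"
  by (simp_all add: zero_quat_def one_quat_def plus_quat_def uminus_quat_def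
      minus_quat_def times_quat_def)

instantiation quat :: real_algebra_1
begin

definition "scaleR r x = Quat (r * q0 x) (r * q1 x) (r * q2 x) (r * q3 x)"

instance
  by standard (simp_all add: quat_eq_iff scaleR_quat_def algebra_simps)

end

lemma quat_sel_scaleR [simp]:
  "q0 (r *\<^sub>R x) = r * q0 x" "q1 (r *\<^sub>R x) = r * q1 x"
  "q2 (r *\<^sub>R x) = r * q2 x" "q3 (r *\<^sub>R x) = r * q3 x"
  by (simp_all add: scaleR_quat_def)

lemma quat_sel_of_real [simp]:
  "q0 (of_real r) = r" "q1 (of_real r) = 0" "q2 (of_real r) = 0" "q3 (of_real r) = 0"
  by (simp_all add: of_real_def)

instantiation quat :: real_inner
begin

definition "inner x y = q0 x * q0 y + q1 x * q1 y + q2 x * q2 y + q3 x * q3 y"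
definition "norm (x::quat) = sqrt (inner x x)"
definition "sgn (x::quat) = x /\<^sub>R norm x"
definition "dist (x::quat) y = norm (x - y)"
definition [code del]:
  "(uniformity :: (quat \<times> quat) filter) = (INF e\<in>{0 <..}. principal {(x, y). dist x y < e})"
definition [code del]:
  "open (U :: quat set) \<longleftrightarrow> (\<forall>x\<in>U. eventually (\<lambda>(x', y). x' = x \<longrightarrow> y \<in> U) uniformity)"

instance
proof
  fix x y z :: quat and r :: real
  show "inner x x = 0 \<longleftrightarrow> x = 0"
    by (simp add: inner_quat_def quat_eq_iff add_nonneg_eq_0_iff add_nonneg_nonneg)
  show "0 \<le> inner x x"
    by (simp add: inner_quat_def)
qed (simp_all add: inner_quat_def norm_quat_def sgn_quat_def dist_quat_def
      uniformity_quat_def open_quat_def algebra_simps)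

end

instantiation quat :: euclidean_space
begin

definition "Basis = {Quat 1 0 0 0, Quat 0 1 0 0, Quat 0 0 1 0, Quat 0 0 0 1}"

instance
proof
  fix x :: quat
  show "(\<forall>u\<in>Basis. inner x u = 0) \<longleftrightarrow> x = 0"
    by (simp add: Basis_quat_def inner_quat_def quat_eq_iff[of x 0])
qed (auto simp: Basis_quat_def inner_quat_def)

end

lemma norm_quat_sq: "(norm x)\<^sup>2 = (q0 x)\<^sup>2 + (q1 x)\<^sup>2 + (q2 x)\<^sup>2 + (q3 x)\<^sup>2"
  unfolding power2_norm_eq_inner by (simp add: inner_quat_def power2_eq_square)

definition qcnj :: "quat \<Rightarrow> quat" where
  "qcnj x = Quat (q0 x) (- q1 x) (- q2 x) (- q3 x)"

lemma qcnj_sel [simp]: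
  "q0 (qcnj x) = q0 x" "q1 (qcnj x) = - q1 x" "q2 (qcnj x) = - q2 x" "q3 (qcnj x) = - q3 x"
  by (simp_all add: qcnj_def)

lemma qcnj_times: "qcnj (x * y) = qcnj y * qcnj x"
  by (simp add: quat_eq_iff algebra_simps)

lemma mult_qcnj: "x * qcnj x = of_real ((norm x)\<^sup>2)" and qcnj_mult: "qcnj x * x = of_real ((norm x)\<^sup>2)"
  unfolding norm_quat_sq quat_eq_iff quat_sel quat_sel_of_real qcnj_sel
  by (simp_all add: power2_eq_square)

instantiation quat :: real_normed_div_algebra
begin

definition "inverse x = qcnj x /\<^sub>R (norm x)\<^sup>2"
definition "x div y = x * inverse y" for x y :: quat

instance
proof
  fix x y :: quat
  show "inverse x * x = 1" and "x * inverse x = 1" if "x \<noteq> 0"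
    using that
    by (simp_all only: inverse_quat_def mult_scaleR_right mult_scaleR_left mult_qcnj qcnj_mult)
      (simp_all add: of_real_def)
  show "norm (x * y) = norm x * norm y"
  proof (rule power2_eq_imp_eq)
    show "(norm (x * y))\<^sup>2 = (norm x * norm y)\<^sup>2"
    proof -
      have "of_real ((norm (x * y))\<^sup>2) = x * (y * qcnj y) * qcnj x"
        by (simp only: mult_qcnj [symmetric] qcnj_times mult.assoc)
      also have "\<dots> = x * ((norm y)\<^sup>2 *\<^sub>R qcnj x)"
        by (simp only: mult_qcnj of_real_def mult_scaleR_right mult_scaleR_left mult_1_right)
      also have "\<dots> = (norm y)\<^sup>2 *\<^sub>R of_real ((norm x)\<^sup>2)"
        by (simp only: mult_scaleR_right mult_qcnj)
      finally have "q0 (of_real ((norm (x * y))\<^sup>2)) = q0 ((norm y)\<^sup>2 *\<^sub>R of_real ((norm x)\<^sup>2))"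
        by (rule arg_cong)
      then show ?thesis
        by (simp only: quat_sel_of_real quat_sel_scaleR power_mult_distrib mult.commute)
    qed
  qed simp_all
qed (simp_all add: inverse_quat_def divide_quat_def)

end

definition qi :: quat where "qi = Quat 0 1 0 0"
definition qj :: quat where "qj = Quat 0 0 1 0"
definition qk :: quat where "qk = Quat 0 0 0 1"

definition qIm :: "quat \<Rightarrow> quat" where
  "qIm x = (x - qcnj x) /\<^sub>R 2"

definition imag_units :: "quat set" (\<open>\<S>\<^sub>H\<close>) where
  "\<S>\<^sub>H = {I. I * I = - 1}"

definition slice_plane :: "quat \<Rightarrow> quat set" (\<open>\<C>\<^bsub>_\<^esub>\<close>) where
  "\<C>\<^bsub>I\<^esub> = span {1, I}"

definition qsphere :: "quat \<Rightarrow> quat set" (\<open>\<S>\<^bsub>_\<^esub>\<close>) where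
  "\<S>\<^bsub>x\<^esub> = {of_real \<alpha> + of_real \<beta> * J | \<alpha> \<beta> I J.
           I \<in> \<S>\<^sub>H \<and> J \<in> \<S>\<^sub>H \<and> x = of_real \<alpha> + of_real \<beta> * I}"

section \<open>Locally slice-regular functions\<close>

text \<open>A function on a set \<open>\<Omega>\<close> of quaternions is a total function on \<^typ>\<open>quat\<close> of which only the values on
  the open set \<open>\<Omega>\<close> are used.\<close>

definition partial :: "quat \<Rightarrow> (quat \<Rightarrow> quat) \<Rightarrow> quat \<Rightarrow> quat" where
  "partial e f x = vector_derivative (\<lambda>t. f (x + t *\<^sub>R e)) (at 0)"

definition dbar :: "(quat \<Rightarrow> quat) \<Rightarrow> quat \<Rightarrow> quat" where
  "dbar f x = (partial 1 f x + qi * partial qi f x + qj * partial qj f x + qk * partial qk f x) /\<^sub>R 2"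

definition vartheta :: "(quat \<Rightarrow> quat) \<Rightarrow> quat \<Rightarrow> quat" where
  "vartheta f x = (partial 1 f x - (qIm x /\<^sub>R (norm (qIm x))\<^sup>2) *
     (q1 x *\<^sub>R partial qi f x + q2 x *\<^sub>R partial qj f x + q3 x *\<^sub>R partial qk f x)) /\<^sub>R 2"

definition C1_on :: "quat set \<Rightarrow> (quat \<Rightarrow> quat) \<Rightarrow> bool" where
  "C1_on \<Omega> f \<longleftrightarrow> (\<exists>f' :: quat \<Rightarrow> quat \<Rightarrow>\<^sub>L quat.
     (\<forall>x\<in>\<Omega>. (f has_derivative blinfun_apply (f' x)) (at x)) \<and> continuous_on \<Omega> f')"

definition holomorphic_on_slice :: "quat \<Rightarrow> quat set \<Rightarrow> (quat \<Rightarrow> quat) \<Rightarrow> bool" where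
  "holomorphic_on_slice I \<Omega> f \<longleftrightarrow> (\<forall>x \<in> \<Omega> \<inter> \<C>\<^bsub>I\<^esub>. \<exists>f'.
     (f has_derivative f') (at x within \<Omega> \<inter> \<C>\<^bsub>I\<^esub>) \<and> (\<forall>v \<in> \<C>\<^bsub>I\<^esub>. f' (I * v) = I * f' v))"

definition SR_loc :: "quat set \<Rightarrow> (quat \<Rightarrow> quat) set" where
  "SR_loc \<Omega> = {f. C1_on \<Omega> f \<and>
     (\<forall>I \<in> \<S>\<^sub>H. \<Omega> \<inter> \<C>\<^bsub>I\<^esub> \<noteq> {} \<longrightarrow> holomorphic_on_slice I \<Omega> f) \<and>
     (\<forall>y \<in> \<Omega>. locally (\<lambda>U. dbar f constant_on U) (\<S>\<^bsub>y\<^esub> \<inter> \<Omega>) \<and>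
              locally (\<lambda>U. dbar (\<lambda>x. x * f x) constant_on U) (\<S>\<^bsub>y\<^esub> \<inter> \<Omega>))}"

definition SC_loc :: "quat set \<Rightarrow> (quat \<Rightarrow> quat) set" where
  "SC_loc \<Omega> = {f \<in> SR_loc \<Omega>. \<forall>x \<in> \<Omega> - \<real>. vartheta f x = 0}"

definition degenerate_set :: "quat set \<Rightarrow> (quat \<Rightarrow> quat) \<Rightarrow> quat set" where
  "degenerate_set \<Omega> f = {x \<in> \<Omega>. dbar f x = 0}"

section \<open>Quasi-open maps\<close>

definition quasi_open_map :: "'a topology \<Rightarrow> 'b topology \<Rightarrow> ('a \<Rightarrow> 'b) \<Rightarrow> bool" where
  "quasi_open_map X Y g \<longleftrightarrow> continuous_map X Y g \<and>
     (\<forall>y \<in> g ` topspace X. \<forall>U. openin X U \<and>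
        (\<exists>C \<in> connected_components_of (subtopology X {x \<in> topspace X. g x = y}).
           compactin X C \<and> C \<subseteq> U) \<longrightarrow>
        y \<in> Y interior_of (g ` U))"

section \<open>Slice-regular functions and their normal functions\<close>

text \<open>The pair \<open>(a, b)\<close> stands for \<open>a + \<iota>b\<close> in the complexified quaternions, where \<open>\<iota>\<close> is
  central.\<close>

type_synonym cquat = "quat \<times> quat"

definition cq_iota :: "cquat \<Rightarrow> cquat" where
  "cq_iota w = (- snd w, fst w)"

definition cq_bar :: "cquat \<Rightarrow> cquat" where
  "cq_bar w = (fst w, - snd w)"

definition cq_conj :: "cquat \<Rightarrow> cquat" where
  "cq_conj w = (qcnj (fst w), qcnj (snd w))"

definition cq_mult :: "cquat \<Rightarrow> cquat \<Rightarrow> cquat" where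
  "cq_mult v w = (fst v * fst w - snd v * snd w, fst v * snd w + snd v * fst w)"

definition circularization :: "complex set \<Rightarrow> quat set" where
  "circularization D = {of_real \<alpha> + J * of_real \<beta> | \<alpha> \<beta> J. Complex \<alpha> \<beta> \<in> D \<and> J \<in> \<S>\<^sub>H}"

definition stem_on :: "complex set \<Rightarrow> (complex \<Rightarrow> cquat) \<Rightarrow> bool" where
  "stem_on D F \<longleftrightarrow> (\<forall>z\<in>D. F (cnj z) = cq_bar (F z))"

definition stem_holomorphic_on :: "complex set \<Rightarrow> (complex \<Rightarrow> cquat) \<Rightarrow> bool" where
  "stem_holomorphic_on D F \<longleftrightarrow>
     (\<forall>z\<in>D. \<exists>F'. (F has_derivative F') (at z) \<and> (\<forall>v. F' (\<i> * v) = cq_iota (F' v)))"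

text \<open>To evaluate at \<open>x\<close> we use the representation \<open>x = \<alpha> + J\<beta>\<close> with \<open>\<beta> = |Im x|\<close> and
  \<open>J = Im x / |Im x|\<close>. For real \<open>x\<close> this reads \<open>J = 0\<close>, which is harmless because the second
  component of a stem function vanishes on the real axis. By \<open>slice_map_eq\<close> below, any other
  representation of \<open>x\<close> gives the same value.\<close>

definition slice_map :: "(complex \<Rightarrow> cquat) \<Rightarrow> quat \<Rightarrow> quat" where
  "slice_map F x = (let z = Complex (q0 x) (norm (qIm x)) in fst (F z) + sgn (qIm x) * snd (F z))"

lemma imag_unitsD:
  assumes "J \<in> \<S>\<^sub>H" shows "q0 J = 0" "norm J = 1"
proof -
  have "norm J * norm J = 1"
    using assms by (metis (mono_tags) imag_units_def mem_Collect_eq norm_minus_cancel norm_mult norm_one)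
  then show n: "norm J = 1"
    by (metis abs_norm_cancel real_sqrt_abs2 real_sqrt_one)
  have e: "q0 J * q0 J - q1 J * q1 J - q2 J * q2 J - q3 J * q3 J = - 1"
    using assms unfolding imag_units_def by (metis (mono_tags) mem_Collect_eq quat_sel(5,13,21))
  have "(q0 J)\<^sup>2 + (q1 J)\<^sup>2 + (q2 J)\<^sup>2 + (q3 J)\<^sup>2 = 1"
    using n norm_quat_sq[of J] by simp
  with e have "(q0 J)\<^sup>2 = 0"
    unfolding power2_eq_square by linarith
  then show "q0 J = 0" by simp
qed

lemma slice_map_eq:
  assumes "stem_on D F" "Complex \<alpha> \<beta> \<in> D" "J \<in> \<S>\<^sub>H"
  shows "slice_map F (of_real \<alpha> + J * of_real \<beta>)
           = fst (F (Complex \<alpha> \<beta>)) + J * snd (F (Complex \<alpha> \<beta>))"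
proof -
  note J = imag_unitsD[OF assms(3)]
  let ?x = "of_real \<alpha> + J * of_real \<beta> :: quat"
  have im: "qIm ?x = \<beta> *\<^sub>R J" and re: "q0 ?x = \<alpha>"
    using J by (simp_all add: qIm_def quat_eq_iff)
  have stem: "F (Complex \<alpha> (- \<beta>)) = cq_bar (F (Complex \<alpha> \<beta>))"
    using assms(1,2) by (auto simp: stem_on_def complex_cnj)
  have 0: "snd (F (Complex \<alpha> \<beta>)) = 0" if "\<beta> = 0"
  proof -
    have "snd (F (Complex \<alpha> \<beta>)) = - snd (F (Complex \<alpha> \<beta>))"
      using stem that by (simp add: cq_bar_def prod_eq_iff)
    then show ?thesis
      by (simp add: quat_eq_iff)
  qed
  show ?thesis
    unfolding slice_map_def Let_def im re using J stem 0
    by (cases "\<beta> = 0"; cases "\<beta> > 0") (auto simp: sgn_div_norm cq_bar_def)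
qed

definition induces :: "complex set \<Rightarrow> (complex \<Rightarrow> cquat) \<Rightarrow> quat set \<Rightarrow> (quat \<Rightarrow> quat) \<Rightarrow> bool" where
  "induces D F G g \<longleftrightarrow> open D \<and> cnj ` D = D \<and> G = circularization D \<and>
     stem_on D F \<and> (\<forall>x\<in>G. g x = slice_map F x)"

definition slice_regular_on :: "quat set \<Rightarrow> (quat \<Rightarrow> quat) \<Rightarrow> bool" where
  "slice_regular_on G g \<longleftrightarrow> (\<exists>D F. induces D F G g \<and> stem_holomorphic_on D F)"

text \<open>The set \<open>D\<close> and the values of \<open>F\<close> on \<open>D\<close> are determined by \<open>g\<close> on \<open>G\<close>, so the choice below
  does not affect the normal function on \<open>G\<close>.\<close>

definition normal_function :: "quat set \<Rightarrow> (quat \<Rightarrow> quat) \<Rightarrow> quat \<Rightarrow> quat" where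
  "normal_function G g = (let F = (SOME F. \<exists>D. induces D F G g)
     in slice_map (\<lambda>z. cq_mult (F z) (cq_conj (F z))))"

section \<open>Wings\<close>

definition wing :: "quat set \<Rightarrow> (quat \<Rightarrow> quat) \<Rightarrow> quat \<Rightarrow> quat set" where
  "wing G g c = top_of_set G closure_of ({x \<in> G. g x = c} - degenerate_set G g)"

definition slice_wings :: "quat set \<Rightarrow> (quat \<Rightarrow> quat) \<Rightarrow> quat set" where
  "slice_wings G g = (\<Union>c \<in> {c. \<forall>x\<in>G. normal_function G (\<lambda>x. g x - c) x = 0}. wing G g c)"

definition symmetric_completion :: "quat set \<Rightarrow> quat set" where
  "symmetric_completion V = (\<Union>x\<in>V. \<S>\<^bsub>x\<^esub>)"

definition local_extension ::
    "quat set \<Rightarrow> (quat \<Rightarrow> quat) \<Rightarrow> quat \<Rightarrow> quat set \<times> (quat \<Rightarrow> quat) \<Rightarrow> bool" where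
  "local_extension \<Omega> f y = (\<lambda>(V, g). open V \<and> connected V \<and> y \<in> V \<and> V \<subseteq> \<Omega> \<and>
     slice_regular_on (symmetric_completion V) g \<and> (\<forall>x\<in>V. g x = f x))"

text \<open>For locally slice-regular \<open>f\<close>, every point of \<open>\<Omega>\<close> has a local extension. One is fixed at
  each point; two local extensions near a common point have the same wings there, so the union
  does not depend on these choices.\<close>

definition wing_set :: "quat set \<Rightarrow> (quat \<Rightarrow> quat) \<Rightarrow> quat set" where
  "wing_set \<Omega> f = (\<Union>y\<in>\<Omega>. let (V, g) = (SOME p. local_extension \<Omega> f y p)
     in slice_wings (symmetric_completion V) g \<inter> V)"

end

theory Submission
  imports Defs "HOL-Complex_Analysis.Complex_Analysis"
begin

text \<open>
  Since \<open>f\<close> is holomorphic on slices, \<open>f(x) = x\<^sup>* A - B\<close> with \<open>A = dbar f\<close>, \<open>B = dbar (x f)\<close> and \<open>x\<^sup>*\<close>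
  the conjugate of \<open>x\<close>. As \<open>A\<close> and \<open>B\<close> are locally constant on spheres, \<open>f(\<alpha> + J\<beta>) = F\<^sub>1 + J F\<^sub>2\<close>
  locally, for a holomorphic stem function \<open>F\<close> with \<open>F\<^sub>2 = - \<beta> dbar f\<close>.

  The value \<open>c\<close> is taken
    by \<open>F\<^sub>1 + J F\<^sub>2\<close> for some imaginary unit \<open>J\<close> iff the holomorphic function
  \<open>h\<^sub>c = (F - c)(F - c)\<^sup>c\<close> vanishes, and \<open>J = - (F\<^sub>1 - c) F\<^sub>2\<^sup>-\<^sup>1\<close> if \<open>F\<^sub>2\<close> is nonzero. If \<open>h\<^sub>c\<close> is not
  identically zero, its zeros are stable in \<open>c\<close> by Hurwitz's theorem; so \<open>f\<close> is open at every
  non-degenerate preimage of \<open>c\<close>, and on every neighbourhood of a whole sphere on which it takes the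
  value \<open>c\<close>. This gives openness off the degenerate set and the wings, as \<open>h\<^sub>c\<close> vanishes identically
  only on wings and degenerate points.

  For quasi-openness, take a point \<open>x\<close> of the compact component with maximal real part. If \<open>x\<close> is
  degenerate and not real, compactness forces the component to contain the whole sphere of \<open>x\<close>. So
  either \<open>f\<close> is open there, or \<open>h\<^sub>c\<close> vanishes identically near \<open>x\<close>; but then the root \<open>J\<close> continues
  in the direction of increasing real part, inside the component.
\<close>

section \<open>Slice coordinates\<close>

text \<open>For an imaginary unit \<open>J\<close> this embeds the complex plane isometrically as
  the slice of \<open>J\<close>. The unit stands on the left, matching the values
  \<open>F1 + J F2\<close> of slice functions.\<close>

definition slice_pt :: "quat \<Rightarrow> complex \<Rightarrow> quat" where
  "slice_pt J z = of_real (Re z) + J * of_real (Im z)"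

lemma slice_pt_sel [simp]:
  "q0 (slice_pt J z) = Re z + Im z * q0 J" "q1 (slice_pt J z) = Im z * q1 J"
  "q2 (slice_pt J z) = Im z * q2 J" "q3 (slice_pt J z) = Im z * q3 J"
  by (simp_all add: slice_pt_def)

lemma imag_units_iff: "J \<in> \<S>\<^sub>H \<longleftrightarrow> q0 J = 0 \<and> norm J = 1"
proof
  assume "q0 J = 0 \<and> norm J = 1"
  then show "J \<in> \<S>\<^sub>H"
    using norm_quat_sq[of J] by (auto simp: imag_units_def quat_eq_iff power2_eq_square)
qed (auto dest: imag_unitsD)

lemma imag_units_square: "J \<in> \<S>\<^sub>H \<Longrightarrow> J * J = - 1"
  by (simp add: imag_units_def)

lemma imag_units_uminus: "J \<in> \<S>\<^sub>H \<Longrightarrow> - J \<in> \<S>\<^sub>H"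
  by (simp add: imag_units_def)

lemma qi_imag_unit [simp]: "qi \<in> \<S>\<^sub>H"
  by (simp add: imag_units_def qi_def quat_eq_iff)

lemma qIm_sel [simp]: "q0 (qIm x) = 0" "q1 (qIm x) = q1 x" "q2 (qIm x) = q2 x" "q3 (qIm x) = q3 x"
  by (simp_all add: qIm_def)

lemma quat_of_real_commute: "x * of_real r = of_real r * (x :: quat)"
  by (simp add: quat_eq_iff algebra_simps)

lemma slice_pt_uminus: "slice_pt (- J) z = slice_pt J (cnj z)"
  by (simp add: slice_pt_def)

lemma slice_pt_real: "Im z = 0 \<Longrightarrow> slice_pt J z = of_real (Re z)"
  by (simp add: slice_pt_def)

lemma bounded_linear_slice_pt: "bounded_linear (slice_pt J)"
proof (rule bounded_linear_intro[where K = "1 + norm J"])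
  fix x y :: complex and r :: real
  show "slice_pt J (x + y) = slice_pt J x + slice_pt J y" "slice_pt J (r *\<^sub>R x) = r *\<^sub>R slice_pt J x"
    by (simp_all add: quat_eq_iff algebra_simps)
  have "norm (slice_pt J x) \<le> \<bar>Re x\<bar> + norm J * \<bar>Im x\<bar>"
    unfolding slice_pt_def by (rule norm_triangle_le) (simp add: norm_mult)
  also have "\<dots> \<le> norm x + norm J * norm x"
    by (intro add_mono mult_left_mono abs_Re_le_cmod abs_Im_le_cmod) auto
  finally show "norm (slice_pt J x) \<le> norm x * (1 + norm J)"
    by (simp add: algebra_simps)
qed

lemma norm_slice_pt: assumes "J \<in> \<S>\<^sub>H" shows "norm (slice_pt J z) = norm z"
proof -
  have "(norm J)\<^sup>2 = 1" "q0 J = 0" using imag_unitsD[OF assms] by auto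
  then have J: "(q1 J)\<^sup>2 + (q2 J)\<^sup>2 + (q3 J)\<^sup>2 = 1" unfolding norm_quat_sq by simp
  have "(norm (slice_pt J z))\<^sup>2 = (Re z)\<^sup>2 + (Im z)\<^sup>2 * ((q1 J)\<^sup>2 + (q2 J)\<^sup>2 + (q3 J)\<^sup>2)"
    unfolding norm_quat_sq using \<open>q0 J = 0\<close> by (simp add: algebra_simps power_mult_distrib)
  then have "(norm (slice_pt J z))\<^sup>2 = (norm z)\<^sup>2"
    by (simp add: J cmod_power2)
  then show ?thesis by simp
qed

lemma slice_pt_diff: "slice_pt J z - slice_pt J w = slice_pt J (z - w)"
  by (simp add: slice_pt_def algebra_simps)

lemma dist_slice_pt: "J \<in> \<S>\<^sub>H \<Longrightarrow> dist (slice_pt J z) (slice_pt J w) = dist z w"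
  by (simp add: dist_norm slice_pt_diff norm_slice_pt)

lemma slice_pt_diff_units: "slice_pt J z - slice_pt I z = Im z *\<^sub>R (J - I)"
  by (simp add: slice_pt_def quat_eq_iff algebra_simps)

lemma dist_slice_pt_units: "dist (slice_pt J z) (slice_pt I z) = \<bar>Im z\<bar> * dist J I"
  by (simp add: dist_norm slice_pt_diff_units)

lemma qIm_slice_pt: "J \<in> \<S>\<^sub>H \<Longrightarrow> qIm (slice_pt J z) = Im z *\<^sub>R J"
  using imag_unitsD[of J] by (simp add: quat_eq_iff)

section \<open>Upper half-plane coordinate and imaginary unit of a quaternion\<close>

definition slice_coord :: "quat \<Rightarrow> complex" where
  "slice_coord x = Complex (q0 x) (norm (qIm x))"

text \<open>At real points \<open>sgn\<close> would give 0; \<open>qi\<close> is an arbitrary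
  default there, since \<open>slice_pt J z\<close> ignores \<open>J\<close> when \<open>z\<close> is
  real. The result is thus always an imaginary unit.\<close>

definition slice_unit :: "quat \<Rightarrow> quat" where
  "slice_unit x = (if qIm x = 0 then qi else sgn (qIm x))"

lemma slice_unit_in_imag_units: "slice_unit x \<in> \<S>\<^sub>H"
  using qi_imag_unit by (auto simp: slice_unit_def imag_units_iff norm_sgn sgn_div_norm)

lemma slice_pt_unit_coord: "slice_pt (slice_unit x) (slice_coord x) = x"
proof (cases "qIm x = 0")
  case True
  then show ?thesis by (simp add: slice_unit_def slice_coord_def quat_eq_iff qi_def)
next
  case False
  then show ?thesis
    by (simp add: slice_unit_def slice_coord_def quat_eq_iff sgn_div_norm)
qed

text \<open>The pairs \<open>(J, z)\<close> and \<open>(- J, cnj z)\<close> describe the same point,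
  and \<open>slice_coord\<close> picks the one in the closed upper half-plane.\<close>

lemma slice_coord_slice_pt:
  assumes "J \<in> \<S>\<^sub>H"
  shows "slice_coord (slice_pt J z) = (if Im z \<ge> 0 then z else cnj z)"
  using imag_unitsD[OF assms] by (simp add: slice_coord_def qIm_slice_pt[OF assms] complex_eq_iff)

lemma Im_slice_coord_nonneg: "Im (slice_coord x) \<ge> 0"
  by (simp add: slice_coord_def)

lemma bounded_linear_qsel:
  "bounded_linear q0" "bounded_linear q1" "bounded_linear q2" "bounded_linear q3"
  using bounded_linear_inner_left[of "1 :: quat"] bounded_linear_inner_left[of qi]
    bounded_linear_inner_left[of qj] bounded_linear_inner_left[of qk]
  by (simp_all add: inner_quat_def qi_def qj_def qk_def)

lemmas continuous_on_qsel = bounded_linear_qsel[THEN linear_continuous_on]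

lemma bounded_linear_qcnj: "bounded_linear qcnj"
  by (rule bounded_linear_intro[where K = 1])
    (simp_all add: quat_eq_iff norm_quat_def inner_quat_def)

lemma bounded_linear_qIm: "bounded_linear qIm"
proof -
  have "bounded_linear (\<lambda>x. (1/2) *\<^sub>R (x - qcnj x))"
    by (intro bounded_linear_const_scaleR bounded_linear_sub bounded_linear_ident bounded_linear_qcnj)
  moreover have "qIm = (\<lambda>x. (1/2) *\<^sub>R (x - qcnj x))" by (auto simp: qIm_def)
  ultimately show ?thesis by simp
qed

lemma continuous_on_qIm: "continuous_on A qIm"
  by (rule linear_continuous_on[OF bounded_linear_qIm])

lemma continuous_on_slice_coord: "continuous_on A slice_coord"
  unfolding slice_coord_def[abs_def] Complex_eq
  by (intro continuous_intros continuous_on_qsel continuous_on_qIm)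

section \<open>Topology of the sphere of imaginary units\<close>

lemma compact_imag_units: "compact \<S>\<^sub>H"
proof -
  have "\<S>\<^sub>H = sphere 0 1 \<inter> q0 -` {0}" by (auto simp: imag_units_iff)
  moreover have "closed (q0 -` {0})"
    by (intro closed_vimage continuous_on_qsel) auto
  ultimately show ?thesis by (metis compact_Int_closed compact_sphere)
qed

text \<open>A linear isometry from a three-dimensional space onto the purely imaginary quaternions
  carries its unit sphere onto the imaginary units.\<close>

lemma connected_imag_units: "connected \<S>\<^sub>H"
proof -
  define h where "h = (\<lambda>p :: complex \<times> real. Quat 0 (Re (fst p)) (Im (fst p)) (snd p))"
  have n: "norm (h p) = norm p" for p
    by (simp add: h_def norm_quat_def inner_quat_def norm_prod_def cmod_power2 power2_eq_square[symmetric])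
  have "bounded_linear h"
  proof (rule bounded_linear_intro[where K = 1])
    show "norm (h p) \<le> norm p * 1" for p by (simp add: n)
  qed (simp_all add: h_def quat_eq_iff)
  then have "continuous_on (sphere 0 1) h" by (rule linear_continuous_on)
  moreover have "connected (sphere (0 :: complex \<times> real) 1)"
    by (rule connected_sphere) simp
  ultimately have "connected (h ` sphere 0 1)" by (rule connected_continuous_image)
  moreover have "\<S>\<^sub>H = h ` sphere 0 1"
  proof (intro equalityI subsetI)
    fix J assume J: "J \<in> \<S>\<^sub>H"
    have "J = h (Complex (q1 J) (q2 J), q3 J)"
      using J by (simp add: h_def imag_units_iff quat_eq_iff)
    moreover from this have "(Complex (q1 J) (q2 J), q3 J) \<in> sphere 0 1"
      using J n[of "(Complex (q1 J) (q2 J), q3 J)"] by (simp add: imag_units_iff)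
    ultimately show "J \<in> h ` sphere 0 1" by (rule image_eqI)
  next
    fix J assume "J \<in> h ` sphere 0 1"
    then show "J \<in> \<S>\<^sub>H" by (auto simp: imag_units_iff n) (simp add: h_def)
  qed
  ultimately show ?thesis by simp
qed

text \<open>A cap is the radial projection of a convex cone of imaginary quaternions.\<close>

lemma connected_cap:
  assumes "s \<ge> 0" shows "connected {J \<in> \<S>\<^sub>H. inner J I > s}"
proof -
  let ?K = "{v. q0 v = 0 \<and> s * norm v < inner v I}"
  have "convex ?K"
  proof (rule convexI)
    fix x y :: quat and u v :: real
    assume x: "x \<in> ?K" and y: "y \<in> ?K" and uv: "0 \<le> u" "0 \<le> v" "u + v = 1"
    have "s * norm (u *\<^sub>R x + v *\<^sub>R y) \<le> s * (u * norm x + v * norm y)"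
      using assms uv norm_triangle_ineq[of "u *\<^sub>R x" "v *\<^sub>R y"] by (intro mult_left_mono) auto
    also have "\<dots> = u * (s * norm x) + v * (s * norm y)" by (simp add: algebra_simps)
    \<comment> \<open>The inequality is strict because one weight is positive: the strict bound for
      \<open>y\<close> is used if \<open>u = 0\<close>, that for \<open>x\<close> otherwise.\<close>
    also have "\<dots> < u * inner x I + v * inner y I"
    proof (cases "u = 0")
      case True with uv y show ?thesis by simp
    next
      case False
      then have "u * (s * norm x) < u * inner x I" using x uv by auto
      moreover have "v * (s * norm y) \<le> v * inner y I"
        using y uv by (intro mult_left_mono) auto
      ultimately show ?thesis by linarith
    qed
    finally show "u *\<^sub>R x + v *\<^sub>R y \<in> ?K" using x y by (simp add: inner_add_left)
  qed
  then have "connected ?K" by (rule convex_connected)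
  moreover have "continuous_on ?K sgn"
    by (intro continuous_on_sgn continuous_on_id) auto
  moreover have "{J \<in> \<S>\<^sub>H. inner J I > s} = sgn ` ?K"
  proof (intro equalityI subsetI)
    fix J assume "J \<in> {J \<in> \<S>\<^sub>H. inner J I > s}"
    then have "J \<in> ?K" "sgn J = J" by (auto simp: imag_units_iff sgn_div_norm)
    then show "J \<in> sgn ` ?K" by (metis imageI)
  next
    fix J assume "J \<in> sgn ` ?K"
    then obtain v where v: "v \<in> ?K" "J = sgn v" by auto
    then have "v \<noteq> 0" by auto
    then have "inner (sgn v) I > s"
      using v by (simp add: sgn_div_norm field_simps)
    then show "J \<in> {J \<in> \<S>\<^sub>H. inner J I > s}"
      using v \<open>v \<noteq> 0\<close> by (auto simp: imag_units_iff norm_sgn sgn_div_norm)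
  qed
  ultimately show ?thesis by (simp only: connected_continuous_image)
qed

text \<open>Every imaginary unit is a limit of others, which lets one evaluate a stem function from two
  different slices.\<close>

lemma imag_unit_nearby:
  assumes "J \<in> \<S>\<^sub>H" "e > 0" obtains I where "I \<in> \<S>\<^sub>H" "I \<noteq> J" "dist I J < e"
proof -
  have "- qi \<noteq> qi" by (simp add: qi_def quat_eq_iff)
  then have "\<not> (\<exists>x. \<S>\<^sub>H = {x})"
    using imag_units_uminus[OF qi_imag_unit] qi_imag_unit by (metis singletonD)
  then have "J islimpt \<S>\<^sub>H"
    using connected_imp_perfect[OF connected_imag_units assms(1)] by blast
  then show ?thesis
    using assms that by (auto simp: islimpt_approachable)
qed

section \<open>Slice planes, spheres and axially symmetric sets\<close>

lemma slice_plane_eq: "\<C>\<^bsub>J\<^esub> = range (slice_pt J)"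
proof -
  have "x \<in> \<C>\<^bsub>J\<^esub> \<longleftrightarrow> x \<in> range (slice_pt J)" for x
  proof -
    have "x \<in> \<C>\<^bsub>J\<^esub> \<longleftrightarrow> (\<exists>k l. x = k *\<^sub>R 1 + l *\<^sub>R J)"
      unfolding slice_plane_def span_breakdown_eq span_empty
      by (auto simp: algebra_simps)
    also have "\<dots> \<longleftrightarrow> (\<exists>k l. x = slice_pt J (Complex k l))"
      by (simp add: slice_pt_def quat_eq_iff algebra_simps)
    also have "\<dots> \<longleftrightarrow> x \<in> range (slice_pt J)"
      by (metis complex.collapse rangeE rangeI)
    finally show ?thesis .
  qed
  then show ?thesis by blast
qed

lemma slice_pt_mult_ii: "J \<in> \<S>\<^sub>H \<Longrightarrow> slice_pt J (\<i> * v) = J * slice_pt J v"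
  by (simp add: slice_pt_def distrib_left mult.assoc[symmetric] imag_units_square)

lemma qsphere_slice_pt_subset:
  "J \<in> \<S>\<^sub>H \<Longrightarrow> I \<in> \<S>\<^sub>H \<Longrightarrow> slice_pt I z \<in> \<S>\<^bsub>slice_pt J z\<^esub>"
  unfolding qsphere_def slice_pt_def quat_of_real_commute[of _ "Im z"] mem_Collect_eq
  by (intro exI[of _ "Re z"] exI[of _ "Im z"] exI[of _ J] exI[of _ I]) simp

lemma qsphere_eq: "\<S>\<^bsub>x\<^esub> = {slice_pt J (slice_coord x) | J. J \<in> \<S>\<^sub>H}"
proof (intro equalityI subsetI)
  fix y assume "y \<in> \<S>\<^bsub>x\<^esub>"
  then obtain a b I J where *: "I \<in> \<S>\<^sub>H" "J \<in> \<S>\<^sub>H" "x = of_real a + of_real b * I" "y = of_real a + of_real b * J"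
    unfolding qsphere_def by blast
  then have x: "x = slice_pt I (Complex a b)" and y: "y = slice_pt J (Complex a b)"
    by (simp_all add: slice_pt_def quat_of_real_commute[of _ b])
  show "y \<in> {slice_pt J (slice_coord x) | J. J \<in> \<S>\<^sub>H}"
  proof (cases "b \<ge> 0")
    case True
    then have "slice_coord x = Complex a b" unfolding x using *(1) by (simp add: slice_coord_slice_pt)
    then show ?thesis using *(2) y by auto
  next
    case False
    then have "slice_coord x = cnj (Complex a b)" unfolding x using *(1) by (simp add: slice_coord_slice_pt)
    then have "y = slice_pt (- J) (slice_coord x)" using y by (simp add: slice_pt_uminus)
    then show ?thesis using imag_units_uminus[OF *(2)] by auto
  qed
next
  fix y assume "y \<in> {slice_pt J (slice_coord x) | J. J \<in> \<S>\<^sub>H}"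
  then show "y \<in> \<S>\<^bsub>x\<^esub>"
    using qsphere_slice_pt_subset[OF slice_unit_in_imag_units[of x], of _ "slice_coord x"]
    by (auto simp: slice_pt_unit_coord)
qed

lemma circularization_eq: "circularization D = {slice_pt J z | J z. z \<in> D \<and> J \<in> \<S>\<^sub>H}"
proof -
  have "(\<exists>\<alpha> \<beta> J. x = of_real \<alpha> + J * of_real \<beta> \<and> Complex \<alpha> \<beta> \<in> D \<and> J \<in> \<S>\<^sub>H) \<longleftrightarrow>
    (\<exists>J z. x = slice_pt J z \<and> z \<in> D \<and> J \<in> \<S>\<^sub>H)" for x
    unfolding slice_pt_def by (metis complex.collapse complex.sel)
  then show ?thesis unfolding circularization_def by blast
qed

text \<open>Invariance of \<open>D\<close> under conjugation lets the representative in the upper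
  half-plane decide membership.\<close>

lemma circularization_slice_coord:
  assumes "cnj ` D = D" shows "x \<in> circularization D \<longleftrightarrow> slice_coord x \<in> D"
proof
  assume "x \<in> circularization D"
  then obtain J z where "x = slice_pt J z" "z \<in> D" "J \<in> \<S>\<^sub>H" by (auto simp: circularization_eq)
  moreover have "cnj z \<in> D" using \<open>z \<in> D\<close> assms by blast
  ultimately show "slice_coord x \<in> D" by (simp add: slice_coord_slice_pt)
next
  assume "slice_coord x \<in> D"
  then show "x \<in> circularization D"
    unfolding circularization_eq using slice_pt_unit_coord[of x] slice_unit_in_imag_units
      by (metis (mono_tags, lifting) mem_Collect_eq)
qed

text \<open>Two quaternions lie on the same sphere exactly when their \<open>slice_coord\<close>
  agree.\<close>

lemma symmetric_completion_eq:
  "x \<in> symmetric_completion V \<longleftrightarrow> slice_coord x \<in> slice_coord ` V"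
proof
  assume "x \<in> symmetric_completion V"
  then obtain y J where "y \<in> V" "x = slice_pt J (slice_coord y)" "J \<in> \<S>\<^sub>H"
    by (auto simp: symmetric_completion_def qsphere_eq)
  then show "slice_coord x \<in> slice_coord ` V"
    by (simp add: slice_coord_slice_pt Im_slice_coord_nonneg)
next
  assume "slice_coord x \<in> slice_coord ` V"
  then obtain y where "y \<in> V" "slice_coord x = slice_coord y" by auto
  then have "x = slice_pt (slice_unit x) (slice_coord y)" by (metis slice_pt_unit_coord)
  then have "x \<in> \<S>\<^bsub>y\<^esub>"
    unfolding qsphere_eq using slice_unit_in_imag_units[of x] by blast
  then show "x \<in> symmetric_completion V"
    unfolding symmetric_completion_def using \<open>y \<in> V\<close> by blast
qed

lemma slice_map_slice_pt:
  assumes "stem_on D F" "z \<in> D" "J \<in> \<S>\<^sub>H"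
  shows "slice_map F (slice_pt J z) = fst (F z) + J * snd (F z)"
  using slice_map_eq[OF assms(1) _ assms(3), of "Re z" "Im z"] assms(2) by (simp add: slice_pt_def)

section \<open>Local stem functions\<close>

text \<open>The preimage of \<open>\<Omega>\<close> under \<open>slice_pt J\<close> is open in the
  plane, so the derivative within the slice becomes a full derivative in a complex variable.\<close>

lemma SR_loc_slice_derivative:
  assumes "open \<Omega>" "f \<in> SR_loc \<Omega>" "J \<in> \<S>\<^sub>H" "slice_pt J z \<in> \<Omega>"
  obtains G where "((\<lambda>w. f (slice_pt J w)) has_derivative G) (at z)" "\<And>v. G (\<i> * v) = J * G v"
proof -
  have "slice_pt J z \<in> \<Omega> \<inter> \<C>\<^bsub>J\<^esub>" using assms(4) by (auto simp: slice_plane_eq)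
  then have "holomorphic_on_slice J \<Omega> f" using assms(2,3) unfolding SR_loc_def by blast
  then obtain f' where f': "(f has_derivative f') (at (slice_pt J z) within \<Omega> \<inter> \<C>\<^bsub>J\<^esub>)"
    "\<forall>v \<in> \<C>\<^bsub>J\<^esub>. f' (J * v) = J * f' v"
    using \<open>slice_pt J z \<in> \<Omega> \<inter> \<C>\<^bsub>J\<^esub>\<close> unfolding holomorphic_on_slice_def
      by blast
  let ?W = "slice_pt J -` \<Omega>"
  have W: "open ?W" "z \<in> ?W"
    using assms by (auto intro!: open_vimage linear_continuous_on bounded_linear_slice_pt)
  have "(slice_pt J has_derivative slice_pt J) (at z within ?W)"
    by (intro bounded_linear_imp_has_derivative bounded_linear_slice_pt)
  moreover have "(f has_derivative f') (at (slice_pt J z) within slice_pt J ` ?W)"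
    by (rule has_derivative_subset[OF f'(1)]) (auto simp: slice_plane_eq)
  ultimately have "((\<lambda>w. f (slice_pt J w)) has_derivative (\<lambda>v. f' (slice_pt J v))) (at z within ?W)"
    by (rule has_derivative_in_compose)
  then have "((\<lambda>w. f (slice_pt J w)) has_derivative (\<lambda>v. f' (slice_pt J v))) (at z)"
    unfolding at_within_open[OF W(2,1)] .
  moreover have "f' (slice_pt J (\<i> * v)) = J * f' (slice_pt J v)" for v
    using f'(2) assms(3) by (simp add: slice_pt_mult_ii slice_plane_eq)
  ultimately show thesis by (rule that)
qed

section \<open>Real derivatives and the identity for \<open>dbar\<close>\<close>

lemma SR_loc_derivative:
  assumes "f \<in> SR_loc \<Omega>" "x \<in> \<Omega>"
  obtains L where "(f has_derivative L) (at x)"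
  using assms unfolding SR_loc_def C1_on_def by blast

lemma SR_loc_continuous_on:
  assumes "f \<in> SR_loc \<Omega>" shows "continuous_on \<Omega> f"
  by (metis SR_loc_derivative[OF assms] continuous_at_imp_continuous_on has_derivative_continuous)

lemma partial_eq:
  assumes "(f has_derivative L) (at x)" shows "partial e f x = L e"
proof -
  have "((\<lambda>t. x + t *\<^sub>R e) has_derivative (\<lambda>t. t *\<^sub>R e)) (at 0)"
    by (auto intro!: derivative_eq_intros)
  moreover have "(f has_derivative L) (at (x + 0 *\<^sub>R e))" using assms by simp
  ultimately have "((\<lambda>t. f (x + t *\<^sub>R e)) has_derivative (\<lambda>t. L (t *\<^sub>R e))) (at 0)"
    by (rule has_derivative_compose[where f = "\<lambda>t. x + t *\<^sub>R e"])
  moreover have "L (t *\<^sub>R e) = t *\<^sub>R L e" for t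
    using has_derivative_linear[OF assms] by (rule linear_scale)
  ultimately have "((\<lambda>t. f (x + t *\<^sub>R e)) has_vector_derivative L e) (at 0)"
    by (simp add: has_vector_derivative_def)
  then show ?thesis unfolding partial_def by (rule vector_derivative_at)
qed

lemma dbar_eq:
  assumes "(f has_derivative L) (at x)"
  shows "dbar f x = (L 1 + qi * L qi + qj * L qj + qk * L qk) /\<^sub>R 2"
  by (simp add: dbar_def partial_eq[OF assms])

text \<open>On the sphere through \<open>x\<close> both \<open>dbar\<close> terms are locally constant, so this exhibits \<open>f\<close> as an
  affine function of the imaginary unit there.\<close>

lemma SR_loc_dbar_identity:
  assumes "open \<Omega>" "f \<in> SR_loc \<Omega>" "x \<in> \<Omega>"
  shows "f x = qcnj x * dbar f x - dbar (\<lambda>x. x * f x) x"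
proof -
  obtain L where L: "(f has_derivative L) (at x)"
    using SR_loc_derivative assms by blast
  interpret L: linear L using has_derivative_linear[OF L] .
  define J z where "J = slice_unit x" and "z = slice_coord x"
  have J: "J \<in> \<S>\<^sub>H" and x: "slice_pt J z = x"
    unfolding J_def z_def by (rule slice_unit_in_imag_units slice_pt_unit_coord)+
  obtain G where G: "((\<lambda>w. f (slice_pt J w)) has_derivative G) (at z)" "\<And>v. G (\<i> * v) = J * G v"
    using SR_loc_slice_derivative[OF assms(1,2) J] x assms(3) by metis
  have "((\<lambda>w. f (slice_pt J w)) has_derivative (\<lambda>v. L (slice_pt J v))) (at z)"
    by (rule has_derivative_compose[OF bounded_linear_imp_has_derivative[OF bounded_linear_slice_pt]])
      (simp add: x L)
  then have "G = (\<lambda>v. L (slice_pt J v))" using G(1) has_derivative_unique by blast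
  \<comment> \<open>Holomorphy on the slice through \<open>x\<close> becomes
    \<open>L J = J * L 1\<close>; written out in \<open>qi\<close>, \<open>qj\<close>,
    \<open>qk\<close> it is the Cauchy-Riemann equation \<open>E\<close>.\<close>
  then have "L (slice_pt J \<i>) = J * L (slice_pt J 1)" using G(2)[of 1] by simp
  then have LJ: "L J = J * L 1" by (simp add: slice_pt_def)
  have "J = q1 J *\<^sub>R qi + q2 J *\<^sub>R qj + q3 J *\<^sub>R qk"
    using imag_unitsD[OF J] by (simp add: quat_eq_iff qi_def qj_def qk_def)
  then have "L J = L (q1 J *\<^sub>R qi + q2 J *\<^sub>R qj + q3 J *\<^sub>R qk)" by (rule arg_cong)
  then have E: "q1 J *\<^sub>R L qi + q2 J *\<^sub>R L qj + q3 J *\<^sub>R L qk - J * L 1 = 0"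
    by (simp add: L.add L.scale LJ)
  have "((\<lambda>x. x * f x) has_derivative (\<lambda>v. x * L v + v * f x)) (at x)"
    by (intro has_derivative_mult L has_derivative_ident)
  note M = dbar_eq[OF this]
  have q: "q0 J = 0" using imag_unitsD[OF J] by simp
  \<comment> \<open>The term \<open>- 2 y\<close> comes from \<open>1 + qi^2 + qj^2 + qk^2\<close>,
    and moving \<open>p\<close> past the units costs a multiple of the expression that vanishes by
    \<open>E\<close>.\<close>
  have ring: "(p * a + 1 * y) + qi * (p * b + qi * y) + qj * (p * c + qj * y) + qk * (p * d + qk * y) =
    qcnj p * (a + qi * b + qj * c + qk * d) - 2 *\<^sub>R y
     - (2 * Im z) *\<^sub>R (q1 J *\<^sub>R b + q2 J *\<^sub>R c + q3 J *\<^sub>R d - J * a)"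
    if "p = slice_pt J z" for a b c d y p
    unfolding that by (simp add: quat_eq_iff qi_def qj_def qk_def q) (simp add: algebra_simps)
  have "2 *\<^sub>R dbar (\<lambda>x. x * f x) x = qcnj x * (2 *\<^sub>R dbar f x) - 2 *\<^sub>R f x"
    unfolding M dbar_eq[OF L] using ring[OF x[symmetric], of "L 1" "f x" "L qi" "L qj" "L qk"] E by simp
  then have "2 *\<^sub>R f x = 2 *\<^sub>R (qcnj x * dbar f x - dbar (\<lambda>x. x * f x) x)"
    by (simp add: scaleR_right_diff_distrib)
  then show ?thesis by (simp only: scaleR_cancel_left) simp
qed

text \<open>The definition of \<open>SR_loc\<close> gives local constancy on a possibly disconnected
  part of a sphere; this extracts constancy on connected pieces.\<close>

lemma locally_constant_on_connected:
  assumes "locally (\<lambda>U. g constant_on U) S" "connected T" "T \<subseteq> S" "x \<in> T" "y \<in> T"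
  shows "g x = g y"
proof -
  have "g constant_on T"
  proof (rule locally_constant_imp_constant[OF assms(2)])
    fix a assume "a \<in> T"
    then have "openin (top_of_set S) S" "a \<in> S" using assms(3) by auto
    then obtain u v where uv: "openin (top_of_set S) u" "g constant_on v" "a \<in> u" "u \<subseteq> v"
      using assms(1) unfolding locally_def by metis
    have "openin (top_of_set T) (T \<inter> u)"
      using uv(1) assms(3) by (metis inf.absorb_iff2 inf_commute openin_subtopology_Int2 subtopology_subtopology)
    then show "\<exists>A. openin (top_of_set T) A \<and> a \<in> A \<and> (\<forall>x\<in>A. g x = g a)"
      using uv \<open>a \<in> T\<close> unfolding constant_on_def by (metis IntD2 IntI subsetD)
  qed
  then show ?thesis using assms(4,5) by (auto simp: constant_on_def)
qed

text \<open>The values \<open>G\<close> and \<open>H\<close> on two different slices determine the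
  stem: its second component is the inverse of \<open>I - J\<close> times \<open>G - H\<close>.
  Differentiability on both slices therefore passes to \<open>F\<close>.\<close>

lemma stem_derivative_from_slices:
  assumes "I \<in> \<S>\<^sub>H" "J \<in> \<S>\<^sub>H" "I \<noteq> J"
    and A: "((\<lambda>w. fst (F w) + I * snd (F w)) has_derivative A) (at z)" "\<And>v. A (\<i> * v) = I * A v"
    and B: "((\<lambda>w. fst (F w) + J * snd (F w)) has_derivative B) (at z)" "\<And>v. B (\<i> * v) = J * B v"
  shows "\<exists>F'. (F has_derivative F') (at z) \<and> (\<forall>v. F' (\<i> * v) = cq_iota (F' v))"
proof -
  define k where "k = inverse (I - J)"
  have k: "k * (I - J) = 1" "(I - J) * k = 1" using assms(3) by (simp_all add: k_def)
  define s where "s = (\<lambda>v. k * (A v - B v))"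
  define G H where "G = (\<lambda>w. fst (F w) + I * snd (F w))" and "H = (\<lambda>w. fst (F w) + J * snd (F w))"
  have snd: "snd (F w) = k * (G w - H w)" for w
  proof -
    have "G w - H w = (I - J) * snd (F w)" by (simp add: G_def H_def algebra_simps)
    then show ?thesis using k by (simp add: mult.assoc[symmetric])
  qed
  have F: "F w = (G w - I * (k * (G w - H w)), k * (G w - H w))" for w
    unfolding snd[symmetric] by (simp add: G_def prod_eq_iff)
  have "((\<lambda>w. (G w - I * (k * (G w - H w)), k * (G w - H w))) has_derivative (\<lambda>v. (A v - I * s v, s v))) (at z)"
    unfolding s_def using A(1) B(1)
    by (intro has_derivative_Pair has_derivative_diff has_derivative_mult_right) (simp_all add: G_def H_def)
  then have der: "(F has_derivative (\<lambda>v. (A v - I * s v, s v))) (at z)"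
    unfolding F[abs_def, symmetric] by (simp add: F[symmetric])
  have sq: "I * (I * a) = - a" "J * (J * a) = - a" for a
    using assms(1,2) by (simp_all add: mult.assoc[symmetric] imag_units_square)
  \<comment> \<open>With \<open>F' v = (A v - I * s v, s v)\<close> this is one half of linearity
    over \<open>cq_iota\<close>; the other half follows from it and
    \<open>I * I = - 1\<close>.\<close>
  have s: "s (\<i> * v) = A v - I * s v" for v
  proof -
    have "A v - B v = (I - J) * s v" unfolding s_def using k by (simp add: mult.assoc[symmetric])
    then have Bv: "B v = A v - (I - J) * s v" by (simp add: algebra_simps)
    have "I * A v - J * B v = (I - J) * (A v - I * s v)"
      unfolding Bv by (simp add: algebra_simps sq)
    then have "s (\<i> * v) = k * ((I - J) * (A v - I * s v))" by (simp add: s_def A B)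
    then show ?thesis using k by (simp add: mult.assoc[symmetric])
  qed
  have "(\<lambda>v. (A v - I * s v, s v)) (\<i> * v) = cq_iota ((\<lambda>v. (A v - I * s v, s v)) v)" for v
    by (simp add: s A cq_iota_def algebra_simps sq)
  with der show ?thesis by blast
qed

lemma nearby_slice:
  assumes "open V" "J \<in> \<S>\<^sub>H" "slice_pt J z \<in> V"
  obtains I where "I \<in> \<S>\<^sub>H" "I \<noteq> J" "slice_pt I z \<in> V"
proof -
  obtain e where e: "e > 0" "ball (slice_pt J z) e \<subseteq> V"
    using assms open_contains_ball by blast
  \<comment> \<open>Adding 1 keeps the denominator positive when \<open>z\<close> is real.\<close>
  have "e / (\<bar>Im z\<bar> + 1) > 0" using e by simp
  then obtain I where I: "I \<in> \<S>\<^sub>H" "I \<noteq> J" "dist I J < e / (\<bar>Im z\<bar> + 1)"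
    by (rule imag_unit_nearby[OF assms(2)])
  have "dist (slice_pt I z) (slice_pt J z) \<le> (\<bar>Im z\<bar> + 1) * dist I J"
    unfolding dist_slice_pt_units by (intro mult_right_mono) auto
  also have "\<dots> < e" using I(3) by (simp add: field_simps add_pos_nonneg)
  finally have "slice_pt I z \<in> V" using e by (auto simp: dist_commute)
  with I(1,2) show thesis by (rule that)
qed

text \<open>\<open>F\<close> describes \<open>f\<close> at the points over \<open>D\<close> that lie
  in \<open>V\<close>, which need not be whole spheres, and \<open>D\<close> need not be symmetric.
  The last equation makes the degenerate points off the real axis the zeros of
  \<open>snd F\<close>.\<close>

definition stem_rep :: "(quat \<Rightarrow> quat) \<Rightarrow> quat set \<Rightarrow> complex set \<Rightarrow> (complex \<Rightarrow> cquat) \<Rightarrow> bool" where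
  "stem_rep f V D F \<longleftrightarrow> open V \<and> open D \<and> stem_holomorphic_on D F \<and>
     (\<forall>z\<in>D. \<forall>J\<in>\<S>\<^sub>H. slice_pt J z \<in> V \<longrightarrow>
        f (slice_pt J z) = fst (F z) + J * snd (F z) \<and> snd (F z) = - (Im z *\<^sub>R dbar f (slice_pt J z)))"

text \<open>Over each \<open>z\<close> the units leading into \<open>V\<close> form a connected set,
  so both \<open>dbar\<close> terms are constant there and may be read off on the slice of
  \<open>J0\<close>. Holomorphy of \<open>F\<close> then follows from two slices.\<close>

lemma stem_rep_exists:
  assumes "open \<Omega>" "f \<in> SR_loc \<Omega>" "open V" "V \<subseteq> \<Omega>" "open D" and J0: "J0 \<in> \<S>\<^sub>H"
    and V: "\<And>z. z \<in> D \<Longrightarrow> slice_pt J0 z \<in> V"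
    and conn: "\<And>z. z \<in> D \<Longrightarrow> connected {J \<in> \<S>\<^sub>H. slice_pt J z \<in> V}"
  shows "\<exists>F. stem_rep f V D F"
proof -
  define A B where "A = (\<lambda>z. dbar f (slice_pt J0 z))" and "B = (\<lambda>z. dbar (\<lambda>x. x * f x) (slice_pt J0 z))"
  \<comment> \<open>This splits \<open>qcnj x * A - B\<close> by
    \<open>qcnj x = Re z - Im z J\<close>.\<close>
  define F where "F = (\<lambda>z. (of_real (Re z) * A z - B z, - (Im z *\<^sub>R A z)))"
  have rep: "f (slice_pt J z) = fst (F z) + J * snd (F z) \<and> snd (F z) = - (Im z *\<^sub>R dbar f (slice_pt J z))"
    if "z \<in> D" "J \<in> \<S>\<^sub>H" "slice_pt J z \<in> V" for z J
  proof -
    let ?T = "(\<lambda>J. slice_pt J z) ` {J \<in> \<S>\<^sub>H. slice_pt J z \<in> V}"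
    have T: "connected ?T"
      by (rule connected_continuous_image[OF _ conn[OF that(1)]]) (unfold slice_pt_def, intro continuous_intros)
    have sub: "?T \<subseteq> \<S>\<^bsub>slice_pt J0 z\<^esub> \<inter> \<Omega>" using qsphere_slice_pt_subset[OF J0] assms(4)
      by auto
    have "slice_pt J0 z \<in> \<Omega>" using V that assms(4) by auto
    then have loc: "locally (\<lambda>U. dbar f constant_on U) (\<S>\<^bsub>slice_pt J0 z\<^esub> \<inter> \<Omega>)"
       "locally (\<lambda>U. dbar (\<lambda>x. x * f x) constant_on U) (\<S>\<^bsub>slice_pt J0 z\<^esub> \<inter> \<Omega>)"
      using assms(2) unfolding SR_loc_def by auto
    have m: "slice_pt J z \<in> ?T" "slice_pt J0 z \<in> ?T" using that J0 V by auto
    have "dbar f (slice_pt J z) = A z" "dbar (\<lambda>x. x * f x) (slice_pt J z) = B z"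
      unfolding A_def B_def
      using locally_constant_on_connected[OF loc(1) T sub m] locally_constant_on_connected[OF loc(2) T sub m]
      by auto
    moreover have "f (slice_pt J z) = qcnj (slice_pt J z) * dbar f (slice_pt J z) - dbar (\<lambda>x. x * f x) (slice_pt J z)"
      using SR_loc_dbar_identity assms that by blast
    moreover have "qcnj (slice_pt J z) = of_real (Re z) - Im z *\<^sub>R J"
      using imag_unitsD[OF that(2)] by (simp add: quat_eq_iff)
    ultimately show ?thesis by (simp add: F_def algebra_simps)
  qed
  have "stem_holomorphic_on D F"
    unfolding stem_holomorphic_on_def
  proof
    fix z assume z: "z \<in> D"
    obtain J where J: "J \<in> \<S>\<^sub>H" "J \<noteq> J0" and JV: "slice_pt J z \<in> V"
      by (rule nearby_slice[OF assms(3) J0 V[OF z]])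
    have slice: "\<exists>G. ((\<lambda>w. fst (F w) + I * snd (F w)) has_derivative G) (at z) \<and> (\<forall>v. G (\<i> * v) = I * G v)"
      if I: "I \<in> \<S>\<^sub>H" "slice_pt I z \<in> V" for I
    proof -
      have "slice_pt I z \<in> \<Omega>" using I assms(4) by blast
      then obtain G where G: "((\<lambda>w. f (slice_pt I w)) has_derivative G) (at z)" "\<And>v. G (\<i> * v) = I * G v"
        by (rule SR_loc_slice_derivative[OF assms(1,2) I(1)]) blast
      have "open (slice_pt I -` V)"
        by (intro open_vimage assms(3) linear_continuous_on bounded_linear_slice_pt)
      then have "open (D \<inter> slice_pt I -` V)" using assms(5) by blast
      then have "((\<lambda>w. fst (F w) + I * snd (F w)) has_derivative G) (at z)"
        by (rule has_derivative_transform_within_open[OF G(1)]) (use z I rep in auto)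
      with G(2) show ?thesis by blast
    qed
    show "\<exists>F'. (F has_derivative F') (at z) \<and> (\<forall>v. F' (\<i> * v) = cq_iota (F' v))"
      using slice[OF J(1) JV] slice[OF J0 V[OF z]] stem_derivative_from_slices[OF J(1) J0 J(2)] by blast
  qed
  then show ?thesis unfolding stem_rep_def using rep assms(3,5) by blast
qed

lemma slice_pt_mem_ball:
  assumes "z \<in> ball (slice_coord y) r" shows "slice_pt (slice_unit y) z \<in> ball y r"
  using assms dist_slice_pt[OF slice_unit_in_imag_units, of y "slice_coord y" z] by (simp add: slice_pt_unit_coord)

text \<open>A ball about a real point contains every sphere it meets. Otherwise the bound on the
  radius makes the units over \<open>z\<close> a cap of nonnegative level, which is
  connected.\<close>

lemma connected_sphere_ball:
  assumes "r > 0" "Im (slice_coord y) = 0 \<or> r \<le> Im (slice_coord y)" "z \<in> ball (slice_coord y) r"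
  shows "connected {J \<in> \<S>\<^sub>H. slice_pt J z \<in> ball y r}"
proof -
  define J0 z0 where "J0 = slice_unit y" and "z0 = slice_coord y"
  have J0: "J0 \<in> \<S>\<^sub>H" and y: "slice_pt J0 z0 = y"
    unfolding J0_def z0_def by (rule slice_unit_in_imag_units slice_pt_unit_coord)+
  note r = assms(2)[folded z0_def] and z = assms(3)[folded z0_def]
  show "connected {J \<in> \<S>\<^sub>H. slice_pt J z \<in> ball y r}"
  proof (cases "Im z0 = 0")
    case True
    then have "slice_pt J z0 = y" for J using y by (simp add: slice_pt_real[of z0])
    then have "dist y (slice_pt J z) = dist z0 z" if "J \<in> \<S>\<^sub>H" for J
      using dist_slice_pt[OF that, of z0 z] by simp
    then have "{J \<in> \<S>\<^sub>H. slice_pt J z \<in> ball y r} = \<S>\<^sub>H"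
      using z by auto
    then show ?thesis using connected_imag_units by simp
  next
    case False
    then have r0: "r \<le> Im z0" "0 < Im z0" using r \<open>r > 0\<close> by auto
    have "\<bar>Im z0 - Im z\<bar> < r"
      using z abs_Im_le_cmod[of "z0 - z"] by (simp add: dist_norm)
    then have Im: "Im z > 0" using r0 by auto
    \<comment> \<open>By the law of cosines, \<open>s\<close> is the value of
      \<open>inner J J0\<close> at which \<open>slice_pt J z\<close> has distance \<open>r\<close>
      from \<open>y\<close>.\<close>
    define s where "s = ((Re z0 - Re z)\<^sup>2 + (Im z)\<^sup>2 + (Im z0)\<^sup>2 - r\<^sup>2) / (2 * Im z * Im z0)"
    have "r\<^sup>2 \<le> (Im z0)\<^sup>2" using r0 \<open>r > 0\<close> by (intro power_mono) auto
    then have "s \<ge> 0" unfolding s_def using Im r0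
      by (intro divide_nonneg_nonneg) (auto intro: add_increasing)
    moreover have "{J \<in> \<S>\<^sub>H. slice_pt J z \<in> ball y r} = {J \<in> \<S>\<^sub>H. inner J J0 > s}"
    proof (rule Collect_cong, rule conj_cong[OF refl])
      fix J assume J: "J \<in> \<S>\<^sub>H"
      have q: "q0 J = 0" "q0 J0 = 0" using imag_unitsD J J0 by auto
      have n: "(q1 J)\<^sup>2 + (q2 J)\<^sup>2 + (q3 J)\<^sup>2 = 1" "(q1 J0)\<^sup>2 + (q2 J0)\<^sup>2 + (q3 J0)\<^sup>2 = 1"
        using norm_quat_sq[of J] norm_quat_sq[of J0] imag_unitsD[OF J] imag_unitsD[OF J0] by auto
      have "(dist y (slice_pt J z))\<^sup>2 = (Re z0 - Re z)\<^sup>2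
        + (Im z)\<^sup>2 * ((q1 J)\<^sup>2 + (q2 J)\<^sup>2 + (q3 J)\<^sup>2) + (Im z0)\<^sup>2 * ((q1 J0)\<^sup>2 + (q2 J0)\<^sup>2 + (q3 J0)\<^sup>2)
        - 2 * Im z * Im z0 * inner J J0"
        unfolding dist_norm norm_quat_sq y[symmetric]
        by (simp add: q inner_quat_def power2_eq_square algebra_simps)
      then have d: "(dist y (slice_pt J z))\<^sup>2 = (Re z0 - Re z)\<^sup>2 + (Im z)\<^sup>2 + (Im z0)\<^sup>2 - 2 * Im z * Im z0 * inner J J0"
        unfolding n by simp
      have "slice_pt J z \<in> ball y r \<longleftrightarrow> (dist y (slice_pt J z))\<^sup>2 < r\<^sup>2"
        using \<open>r > 0\<close> by (auto intro: power_strict_mono power2_less_imp_less)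
      also have "\<dots> \<longleftrightarrow> inner J J0 > s"
        unfolding d s_def using Im r0 by (simp add: pos_divide_less_eq) (auto simp: algebra_simps)
      finally show "slice_pt J z \<in> ball y r \<longleftrightarrow> inner J J0 > s" .
    qed
    ultimately show ?thesis using connected_cap by simp
  qed
qed

lemma stem_rep_ball:
  assumes "open \<Omega>" "f \<in> SR_loc \<Omega>" "ball y r \<subseteq> \<Omega>" "r > 0" "Im (slice_coord y) = 0 \<or> r \<le> Im (slice_coord y)"
  shows "\<exists>F. stem_rep f (ball y r) (ball (slice_coord y) r) F"
  using assms slice_pt_mem_ball connected_sphere_ball
  by (intro stem_rep_exists[OF assms(1,2) open_ball _ open_ball slice_unit_in_imag_units[of y]]) auto

text \<open>A tube contains whole spheres, so the units over \<open>z\<close> form the full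
  connected sphere. The bound on \<open>r\<close> keeps the disc in the open upper half-plane, where
  \<open>slice_coord\<close> inverts \<open>slice_pt J\<close>.\<close>

lemma stem_rep_tube:
  assumes "open \<Omega>" "f \<in> SR_loc \<Omega>" "r \<le> Im z0" and "\<And>J z. J \<in> \<S>\<^sub>H \<Longrightarrow> z \<in> ball z0 r \<Longrightarrow> slice_pt J z \<in> \<Omega>"
  shows "\<exists>F. stem_rep f (slice_coord -` ball z0 r) (ball z0 r) F"
proof -
  have pos: "Im z > 0" if "z \<in> ball z0 r" for z
    using that assms(3) abs_Im_le_cmod[of "z0 - z"] by (simp add: dist_norm)
  have in_tube: "slice_pt J z \<in> slice_coord -` ball z0 r" if "J \<in> \<S>\<^sub>H" "z \<in> ball z0 r" for J z
    using that pos[OF that(2)] by (simp add: slice_coord_slice_pt)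
  have "slice_coord -` ball z0 r \<subseteq> \<Omega>"
    using assms(4)[OF slice_unit_in_imag_units] by (metis slice_pt_unit_coord subsetI vimageE)
  moreover have "{J \<in> \<S>\<^sub>H. slice_pt J z \<in> slice_coord -` ball z0 r} = \<S>\<^sub>H" if "z \<in> ball z0 r" for z
    using in_tube that by blast
  ultimately show ?thesis
    using connected_imag_units in_tube[OF qi_imag_unit]
    by (intro stem_rep_exists[OF assms(1,2) _ _ open_ball qi_imag_unit] open_vimage continuous_on_slice_coord)
      auto
qed

text \<open>The sphere over \<open>z0\<close> is compact, hence has a uniform neighbourhood in
  \<open>U\<close>, and \<open>slice_pt J\<close> is an isometry.\<close>

lemma sphere_tube:
  assumes "open U" "\<And>J. J \<in> \<S>\<^sub>H \<Longrightarrow> slice_pt J z0 \<in> U"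
  obtains e where "e > 0" "\<And>J z. J \<in> \<S>\<^sub>H \<Longrightarrow> z \<in> ball z0 e \<Longrightarrow> slice_pt J z \<in> U"
proof -
  let ?K = "(\<lambda>J. slice_pt J z0) ` \<S>\<^sub>H"
  have "compact ?K"
    by (rule compact_continuous_image[OF _ compact_imag_units]) (unfold slice_pt_def, intro continuous_intros)
  then obtain e where e: "e > 0" "(\<Union>x\<in>?K. ball x e) \<subseteq> U"
    using compact_subset_open_imp_ball_epsilon_subset[of ?K U] assms by blast
  show thesis
  proof (rule that[OF e(1)])
    fix J z assume "J \<in> \<S>\<^sub>H" "z \<in> ball z0 e"
    then have "slice_pt J z \<in> ball (slice_pt J z0) e" by (simp add: dist_slice_pt)
    then show "slice_pt J z \<in> U" using e(2) \<open>J \<in> \<S>\<^sub>H\<close> by blast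
  qed
qed

section \<open>The norm form and preimages\<close>

text \<open>The product \<open>w w\<^sup>c\<close>, which lies in the centre \<open>\<real> + \<iota>\<real>\<close>, read as a complex number.\<close>

definition cq_norm :: "cquat \<Rightarrow> complex" where
  "cq_norm w = Complex ((norm (fst w))\<^sup>2 - (norm (snd w))\<^sup>2) (2 * inner (fst w) (snd w))"

lemma cq_norm_eq_0_iff:
  "cq_norm w = 0 \<longleftrightarrow> norm (fst w) = norm (snd w) \<and> inner (fst w) (snd w) = 0"
  by (simp add: cq_norm_def complex_eq_iff)

text \<open>Left multiplication by \<open>J\<close> preserves the norm and turns each vector into an
  orthogonal one.\<close>

lemma cq_norm_eq_0I:
  assumes "J \<in> \<S>\<^sub>H" "fst w + J * snd w = 0" shows "cq_norm w = 0"
proof -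
  have w: "fst w = - (J * snd w)" using assms(2) by (simp add: add_eq_0_iff2)
  have "inner (J * a) a = q0 J * inner a a" for a
    by (simp add: inner_quat_def algebra_simps)
  then show ?thesis
    using imag_unitsD[OF assms(1)] by (simp add: cq_norm_eq_0_iff w norm_mult)
qed

text \<open>The two real equations in \<open>cq_norm w = 0\<close> say that this quotient has norm 1
  and real part 0.\<close>

lemma cq_norm_root:
  assumes "cq_norm w = 0" "snd w \<noteq> 0"
  defines "J \<equiv> - (fst w * inverse (snd w))"
  shows "J \<in> \<S>\<^sub>H" "fst w + J * snd w = 0"
proof -
  have n: "norm (fst w) = norm (snd w)" and i: "inner (fst w) (snd w) = 0"
    using assms(1) by (auto simp: cq_norm_eq_0_iff)
  have "norm J = 1"
    unfolding J_def using n assms(2) by (simp add: norm_mult norm_inverse)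
  moreover have "q0 J = 0"
    unfolding J_def inverse_quat_def using i by (simp add: inner_quat_def algebra_simps)
  ultimately show "J \<in> \<S>\<^sub>H" by (simp add: imag_units_iff)
  show "fst w + J * snd w = 0" unfolding J_def using assms(2) by (simp add: mult.assoc)
qed

lemma cq_norm_root_exists:
  assumes "cq_norm w = 0" shows "\<exists>J\<in>\<S>\<^sub>H. fst w + J * snd w = 0"
proof (cases "snd w = 0")
  case True
  then have "fst w = 0" using assms by (simp add: cq_norm_eq_0_iff)
  then show ?thesis using True by (intro bexI[of _ qi]) auto
qed (use cq_norm_root[OF assms] in blast)

lemma cq_mult_conj:
  "cq_mult w (cq_conj w) = (of_real (Re (cq_norm w)), of_real (Im (cq_norm w)))"
  unfolding cq_norm_def norm_quat_sq
  by (simp add: cq_mult_def cq_conj_def quat_eq_iff inner_quat_def power2_eq_square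
      del: of_real_mult of_real_add of_real_diff)

text \<open>As a sum of squares of the complexified coordinates, the norm form of a holomorphic stem
  is visibly holomorphic.\<close>

lemma cq_norm_components:
  "cq_norm w = (Complex (q0 (fst w)) (q0 (snd w)))\<^sup>2 + (Complex (q1 (fst w)) (q1 (snd w)))\<^sup>2 +
     (Complex (q2 (fst w)) (q2 (snd w)))\<^sup>2 + (Complex (q3 (fst w)) (q3 (snd w)))\<^sup>2"
  unfolding cq_norm_def norm_quat_sq
  by (simp add: complex_eq_iff inner_quat_def power2_eq_square)

section \<open>Holomorphy of the norm form\<close>

lemma stem_holomorphic_shift:
  assumes "stem_holomorphic_on D F" shows "stem_holomorphic_on D (\<lambda>z. F z - (c, 0))"
  unfolding stem_holomorphic_on_def
proof
  fix z assume "z \<in> D"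
  then obtain F' where F': "(F has_derivative F') (at z)" "\<forall>v. F' (\<i> * v) = cq_iota (F' v)"
    using assms unfolding stem_holomorphic_on_def by blast
  have "((\<lambda>z. F z - (c, 0)) has_derivative F') (at z)"
    using has_derivative_diff[OF F'(1) has_derivative_const] by simp
  with F'(2) show "\<exists>F'. ((\<lambda>z. F z - (c, 0)) has_derivative F') (at z) \<and> (\<forall>v. F' (\<i> * v) = cq_iota (F' v))"
    by blast
qed

lemma stem_holomorphic_continuous:
  assumes "stem_holomorphic_on D F" shows "continuous_on D F"
  using assms unfolding stem_holomorphic_on_def
  by (meson continuous_at_imp_continuous_on has_derivative_continuous)

text \<open>The complexification \<open>T\<close> of \<open>q\<close> turns \<open>cq_iota\<close>
  into multiplication by the imaginary unit, so the real derivative of \<open>T\<close> after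
  \<open>F\<close> is complex linear.\<close>

lemma stem_component_holomorphic:
  assumes "open D" "stem_holomorphic_on D F" and q: "bounded_linear (q :: quat \<Rightarrow> real)"
  shows "(\<lambda>z. Complex (q (fst (F z))) (q (snd (F z)))) holomorphic_on D"
  unfolding holomorphic_on_open[OF assms(1)]
proof
  fix z assume "z \<in> D"
  then obtain F' where F': "(F has_derivative F') (at z)" "\<And>v. F' (\<i> * v) = cq_iota (F' v)"
    using assms unfolding stem_holomorphic_on_def by blast
  interpret q: bounded_linear q by fact
  define T where "T = (\<lambda>w. Complex (q (fst w)) (q (snd w)))"
  have "bounded_linear (\<lambda>w. of_real (q (fst w)) + \<i> * of_real (q (snd w)) :: complex)"
    by (intro bounded_linear_add bounded_linear_compose[OF bounded_linear_mult_right]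
        bounded_linear_compose[OF bounded_linear_of_real] bounded_linear_compose[OF q]
        bounded_linear_fst bounded_linear_snd)
  then have "bounded_linear T" by (simp add: T_def Complex_eq)
  then have der: "((\<lambda>z. T (F z)) has_derivative (\<lambda>v. T (F' v))) (at z)"
    using F'(1) bounded_linear.has_derivative by blast
  interpret G: linear "\<lambda>v. T (F' v)" using has_derivative_linear[OF der] .
  have "T (F' (\<i> * v)) = \<i> * T (F' v)" for v
    by (simp add: F' T_def cq_iota_def complex_eq_iff q.neg)
  note ii = this[of 1, simplified]
  have "T (F' v) = T (F' 1) * v" for v
  proof -
    have "v = Re v *\<^sub>R 1 + Im v *\<^sub>R \<i>" by (simp add: complex_eq_iff)
    then have "T (F' v) = T (F' (Re v *\<^sub>R 1 + Im v *\<^sub>R \<i>))" by (rule arg_cong)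
    also have "\<dots> = Re v *\<^sub>R T (F' 1) + Im v *\<^sub>R T (F' \<i>)" by (simp only: G.add G.scale)
    also have "\<dots> = T (F' 1) * v" by (simp add: ii complex_eq_iff algebra_simps)
    finally show ?thesis .
  qed
  then have "(\<lambda>v. T (F' v)) = (*) (T (F' 1))" by (rule ext)
  with der have "((\<lambda>z. T (F z)) has_field_derivative T (F' 1)) (at z)"
    by (simp add: has_field_derivative_def)
  then show "\<exists>f'. ((\<lambda>z. Complex (q (fst (F z))) (q (snd (F z)))) has_field_derivative f') (at z)"
    unfolding T_def by blast
qed

lemma cq_norm_holomorphic:
  assumes "open D" "stem_holomorphic_on D F"
  shows "(\<lambda>z. cq_norm (F z - (c, 0))) holomorphic_on D"
  unfolding cq_norm_components
  by (intro holomorphic_intros stem_component_holomorphic stem_holomorphic_shift assms bounded_linear_qsel)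

lemma continuous_on_cq_norm:
  assumes "continuous_on S g" shows "continuous_on S (\<lambda>x. cq_norm (g x))"
  unfolding cq_norm_def Complex_eq by (intro continuous_intros assms)

text \<open>Hurwitz's theorem, by the maximum modulus principle for the reciprocal.\<close>

lemma cq_norm_zero_stable:
  assumes D: "open D" "connected D" and F: "stem_holomorphic_on D F" and z0: "z0 \<in> D"
    and zero: "cq_norm (F z0 - (c0, 0)) = 0" and nz: "z1 \<in> D" "cq_norm (F z1 - (c0, 0)) \<noteq> 0"
    and r: "r > 0"
  shows "\<exists>e>0. \<forall>c. dist c c0 < e \<longrightarrow> (\<exists>z\<in>D. dist z z0 < r \<and> cq_norm (F z - (c, 0)) = 0)"
proof -
  define h where "h = (\<lambda>c z. cq_norm (F z - (c, 0)))"
  obtain r' where r': "r' > 0" "ball z0 r' \<subseteq> D" "\<And>z. z \<in> ball z0 r' - {z0} \<Longrightarrow> h c0 z \<noteq> 0"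
    using isolated_zeros[OF cq_norm_holomorphic[OF D(1) F] D z0 zero nz] unfolding h_def by blast
  \<comment> \<open>On the closed disc of radius \<open>s\<close>, which lies in \<open>D\<close>,
    the only zero of \<open>h c0\<close> is the centre; \<open>m\<close> below is the minimum
    modulus on its boundary.\<close>
  define s where "s = min r r' / 2"
  have s: "0 < s" "s < r" "s < r'" using r r'(1) by (auto simp: s_def)
  have sD: "cball z0 s \<subseteq> D" using r'(2) s by auto
  have cont: "continuous_on (UNIV \<times> cball z0 s) (\<lambda>p. h (fst p) (snd p))"
    unfolding h_def
    by (intro continuous_on_cq_norm continuous_intros
        continuous_on_compose2[OF stem_holomorphic_continuous[OF F]]) (use sD in auto)
  have cont1: "continuous_on (cball z0 s) (h c)" for c
    using continuous_on_compose2[OF cont, of "cball z0 s" "\<lambda>z. (c, z)"]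
    by (simp add: continuous_on_Pair image_subset_iff)
  have "compact ((\<lambda>z. norm (h c0 z)) ` sphere z0 s)"
    by (intro compact_continuous_image continuous_on_norm continuous_on_subset[OF cont1] compact_sphere) auto
  moreover have "sphere z0 s \<noteq> {}" using s by simp
  ultimately obtain w where w: "w \<in> sphere z0 s" "\<And>z. z \<in> sphere z0 s \<Longrightarrow> norm (h c0 w) \<le> norm (h c0 z)"
    using compact_attains_inf[of "(\<lambda>z. norm (h c0 z)) ` sphere z0 s"] by blast
  define m where "m = norm (h c0 w)"
  have "w \<in> ball z0 r' - {z0}" using w(1) s by auto
  then have "m > 0" unfolding m_def using r'(3) by auto
  \<comment> \<open>Joint uniform continuity in \<open>(c, z)\<close> makes \<open>h c\<close> close
    to \<open>h c0\<close> uniformly on the disc.\<close>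
  have "uniformly_continuous_on (cball c0 1 \<times> cball z0 s) (\<lambda>p. h (fst p) (snd p))"
    by (intro compact_uniformly_continuous compact_Times compact_cball continuous_on_subset[OF cont]) auto
  then obtain d where d: "d > 0" "\<And>p p'. p \<in> cball c0 1 \<times> cball z0 s \<Longrightarrow> p' \<in> cball c0 1 \<times> cball z0 s \<Longrightarrow>
      dist p' p < d \<Longrightarrow> dist (h (fst p') (snd p')) (h (fst p) (snd p)) < m / 2"
    using \<open>m > 0\<close> unfolding uniformly_continuous_on_def by (metis half_gt_zero)
  show ?thesis
  proof (intro exI[of _ "min d 1"] conjI allI impI)
    show "min d 1 > 0" using d by simp
    fix c assume c: "dist c c0 < min d 1"
    have close: "dist (h c z) (h c0 z) < m / 2" if "z \<in> cball z0 s" for z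
      using d(2)[of "(c0, z)" "(c, z)"] that c by (auto simp: dist_prod_def dist_commute)
    show "\<exists>z\<in>D. dist z z0 < r \<and> cq_norm (F z - (c, 0)) = 0"
    proof (rule ccontr)
      assume "\<not> ?thesis"
      then have no: "h c z \<noteq> 0" if "z \<in> cball z0 s" for z
        using that sD s unfolding h_def by (force simp: dist_commute)
      \<comment> \<open>Without zeros of \<open>h c\<close>, its reciprocal at the centre is bounded
        by its boundary values, which contradicts \<open>norm (h c z0) < m / 2\<close>.\<close>
      have "norm (inverse (h c z0)) \<le> 2 / m"
      proof (rule maximum_modulus_frontier[where S = "cball z0 s" and f = "\<lambda>z. inverse (h c z)"])
        show "(\<lambda>z. inverse (h c z)) holomorphic_on interior (cball z0 s)"
          unfolding h_def
          by (intro holomorphic_intros holomorphic_on_subset[OF cq_norm_holomorphic[OF D(1) F]])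
            (use sD no in \<open>auto simp: h_def subset_iff\<close>)
        show "continuous_on (closure (cball z0 s)) (\<lambda>z. inverse (h c z))"
          using no by (auto intro!: continuous_on_inverse cont1)
        fix z assume "z \<in> frontier (cball z0 s)"
        then have z: "z \<in> sphere z0 s" using s by (simp add: frontier_cball)
        have "m \<le> norm (h c0 z)" using w(2)[OF z] by (simp add: m_def)
        also have "\<dots> \<le> norm (h c z) + m / 2"
          using close[of z] z norm_triangle_sub[of "h c0 z" "h c z"]
          by (simp add: dist_norm norm_minus_commute)
        finally have "m / 2 \<le> norm (h c z)" by simp
        then have "inverse (norm (h c z)) \<le> inverse (m / 2)"
          using \<open>m > 0\<close> by (intro le_imp_inverse_le) auto
        then show "norm (inverse (h c z)) \<le> 2 / m"
          by (simp add: norm_divide inverse_eq_divide)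
      qed (use s in auto)
      moreover have "norm (h c z0) < m / 2" using close[of z0] s zero by (simp add: h_def)
      then have "inverse (m / 2) < inverse (norm (h c z0))"
        using no[of z0] s by (intro less_imp_inverse_less) auto
      ultimately show False by (simp add: norm_divide inverse_eq_divide)
    qed
  qed
qed

text \<open>This is the common part of the two openness lemmas: stability supplies zeros for all
  nearby values, and \<open>lift\<close> turns each zero into a preimage in
  \<open>U\<close>.\<close>

lemma interior_image_of_stable_zero:
  assumes D: "open D" "connected D" and F: "stem_holomorphic_on D F" and z0: "z0 \<in> D"
    and zero: "cq_norm (F z0 - (c0, 0)) = 0" and nz: "z1 \<in> D" "cq_norm (F z1 - (c0, 0)) \<noteq> 0"
    and lift: "d > 0" "\<And>z c. z \<in> D \<Longrightarrow> dist z z0 < d \<Longrightarrow> dist c c0 < d \<Longrightarrow>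
      cq_norm (F z - (c, 0)) = 0 \<Longrightarrow> \<exists>x\<in>U. f x = c"
  shows "c0 \<in> interior (f ` U)"
proof -
  obtain e where e: "e > 0"
    "\<And>c. dist c c0 < e \<Longrightarrow> \<exists>z\<in>D. dist z z0 < d \<and> cq_norm (F z - (c, 0)) = 0"
    using cq_norm_zero_stable[OF D F z0 zero nz lift(1)] by blast
  have "ball c0 (min e d) \<subseteq> f ` U"
  proof
    fix c assume "c \<in> ball c0 (min e d)"
    then show "c \<in> f ` U" using e(2)[of c] lift(2)[of _ c] by (auto simp: dist_commute image_iff)
  qed
  then show ?thesis using e(1) lift(1) unfolding mem_interior by (intro exI[of _ "min e d"]) auto
qed

section \<open>Openness at a point and at a sphere\<close>

lemma stem_rep_zero:
  assumes "stem_rep f V D F" "z \<in> D" "J \<in> \<S>\<^sub>H" "slice_pt J z \<in> V"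
  shows "f (slice_pt J z) = fst (F z) + J * snd (F z)" "snd (F z) = - (Im z *\<^sub>R dbar f (slice_pt J z))"
    "f (slice_pt J z) = c \<Longrightarrow> cq_norm (F z - (c, 0)) = 0"
  using assms unfolding stem_rep_def by (auto intro!: cq_norm_eq_0I[OF assms(3)])

text \<open>Where \<open>snd F\<close> is nonzero the root is unique and depends continuously on the
  pair \<open>(z, c)\<close>, so roots near \<open>(z0, c0)\<close> give points close to the given
  one.\<close>

lemma stem_rep_open_at:
  assumes rep: "stem_rep f V D F" and conn: "connected D" and z0: "z0 \<in> D"
    and nz: "z1 \<in> D" "cq_norm (F z1 - (c0, 0)) \<noteq> 0"
    and J0: "J0 \<in> \<S>\<^sub>H" "slice_pt J0 z0 \<in> V \<inter> U" "f (slice_pt J0 z0) = c0" "open U"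
    and ndeg: "snd (F z0) \<noteq> 0"
  shows "c0 \<in> interior (f ` U)"
proof -
  have D: "open D" "stem_holomorphic_on D F" "open V" using rep by (auto simp: stem_rep_def)
  \<comment> \<open>The solution of \<open>fst (F z) - c + J * snd (F z) = 0\<close>; it is an
    imaginary unit once the norm form vanishes at \<open>(z, c)\<close>.\<close>
  define J where "J = (\<lambda>p. - ((fst (F (fst p)) - snd p) * inverse (snd (F (fst p)))))"
  have "isCont F z0"
    using stem_holomorphic_continuous[OF D(2)] D(1) z0 by (simp add: continuous_on_eq_continuous_at)
  then have F: "(F \<longlongrightarrow> F z0) (nhds z0)" by (simp add: isCont_def tendsto_at_iff_tendsto_nhds)
  have lim_fst: "((\<lambda>p. fst p) \<longlongrightarrow> z0) (nhds (z0, c0))" and lim_snd: "((\<lambda>p. snd p) \<longlongrightarrow> c0) (nhds (z0, c0))"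
    using tendsto_fst[OF filterlim_ident[of "nhds (z0, c0)"]] tendsto_snd[OF filterlim_ident[of "nhds (z0, c0)"]]
    by simp_all
  note lim_F = filterlim_compose[OF F lim_fst]
  have "fst (F z0) - c0 = - (J0 * snd (F z0))"
    using stem_rep_zero(1)[OF rep z0 J0(1)] J0 by (simp add: algebra_simps)
  then have "J (z0, c0) = J0" using ndeg by (simp add: J_def mult.assoc)
  moreover have "(J \<longlongrightarrow> J (z0, c0)) (nhds (z0, c0))"
    unfolding J_def using ndeg
    by (auto intro!: tendsto_intros lim_F lim_snd)
  ultimately have "((\<lambda>p. slice_pt (J p) (fst p)) \<longlongrightarrow> slice_pt J0 z0) (nhds (z0, c0))"
    unfolding slice_pt_def by (auto intro!: tendsto_intros lim_fst)
  then have "\<forall>\<^sub>F p in nhds (z0, c0). slice_pt (J p) (fst p) \<in> V \<inter> U"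
    using J0 D(3) by (intro topological_tendstoD[of _ "slice_pt J0 z0"] open_Int) auto
  moreover have "\<forall>\<^sub>F p in nhds (z0, c0). snd (F (fst p)) \<noteq> 0"
    using tendsto_imp_eventually_ne[OF tendsto_snd[OF lim_F] ndeg] by simp
  ultimately have "\<forall>\<^sub>F p in nhds (z0, c0). slice_pt (J p) (fst p) \<in> V \<inter> U \<and> snd (F (fst p)) \<noteq> 0"
    by (rule eventually_conj)
  then obtain d where d: "d > 0"
    "\<And>p. dist p (z0, c0) < d \<Longrightarrow> slice_pt (J p) (fst p) \<in> V \<inter> U \<and> snd (F (fst p)) \<noteq> 0"
    unfolding eventually_nhds_metric by blast
  show ?thesis
  proof (rule interior_image_of_stable_zero[OF D(1) conn D(2) z0 _ nz])
    show "cq_norm (F z0 - (c0, 0)) = 0" using stem_rep_zero(3)[OF rep z0] J0 by auto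
    show "d / 2 > 0" using d by simp
    fix z c assume *: "z \<in> D" "dist z z0 < d / 2" "dist c c0 < d / 2" "cq_norm (F z - (c, 0)) = 0"
    have "dist (z, c) (z0, c0) \<le> dist z z0 + dist c c0"
      unfolding dist_Pair_Pair by (rule sqrt_sum_squares_le_sum) auto
    then have "dist (z, c) (z0, c0) < d" using * by simp
    note d = d(2)[OF this]
    have "J (z, c) = - (fst (F z - (c, 0)) * inverse (snd (F z - (c, 0))))" by (simp add: J_def)
    then have "J (z, c) \<in> \<S>\<^sub>H" "fst (F z) - c + J (z, c) * snd (F z) = 0"
      using cq_norm_root[OF *(4)] d by auto
    then have "f (slice_pt (J (z, c)) z) = c"
      using stem_rep_zero(1)[OF rep *(1), of "J (z, c)"] d by (simp add: algebra_simps)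
    then show "\<exists>x\<in>U. f x = c" using d by auto
  qed
qed

text \<open>Since \<open>U\<close> contains the whole sphere, it contains a tube around it, and any
  root over a nearby \<open>z\<close> lands in that tube, even if roots vary
  discontinuously.\<close>

lemma stem_rep_open_at_sphere:
  assumes rep: "stem_rep f V D F" and conn: "connected D" and z0: "z0 \<in> D"
    and nz: "z1 \<in> D" "cq_norm (F z1 - (c0, 0)) \<noteq> 0"
    and sphere: "\<And>J. J \<in> \<S>\<^sub>H \<Longrightarrow> slice_pt J z0 \<in> V \<inter> U" and "open U"
    and J0: "J0 \<in> \<S>\<^sub>H" "f (slice_pt J0 z0) = c0"
  shows "c0 \<in> interior (f ` U)"
proof -
  have D: "open D" "stem_holomorphic_on D F" "open V" using rep by (auto simp: stem_rep_def)
  obtain d where d: "d > 0" "\<And>J z. J \<in> \<S>\<^sub>H \<Longrightarrow> z \<in> ball z0 d \<Longrightarrow> slice_pt J z \<in> V \<inter> U"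
    using sphere_tube[OF _ sphere] D(3) \<open>open U\<close> by (metis open_Int)
  show ?thesis
  proof (rule interior_image_of_stable_zero[OF D(1) conn D(2) z0 _ nz d(1)])
    show "cq_norm (F z0 - (c0, 0)) = 0" using stem_rep_zero(3)[OF rep z0] J0 sphere by auto
    fix z c assume *: "z \<in> D" "dist z z0 < d" "dist c c0 < d" "cq_norm (F z - (c, 0)) = 0"
    obtain J where J: "J \<in> \<S>\<^sub>H" "fst (F z - (c, 0)) + J * snd (F z - (c, 0)) = 0"
      using cq_norm_root_exists[OF *(4)] by blast
    have "slice_pt J z \<in> V \<inter> U" using d(2)[OF J(1)] *(2) by (simp add: dist_commute)
    moreover from this have "f (slice_pt J z) = c"
      using stem_rep_zero(1)[OF rep *(1) J(1)] J(2) by (simp add: algebra_simps)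
    ultimately show "\<exists>x\<in>U. f x = c" by blast
  qed
qed

section \<open>Wings\<close>

lemma dist_slice_coord_le: "dist (slice_coord x) (slice_coord y) \<le> dist x y"
proof (rule power2_le_imp_le)
  have "\<bar>norm (qIm x) - norm (qIm y)\<bar> \<le> norm (qIm x - qIm y)" by (rule norm_triangle_ineq3)
  then have "(norm (qIm x) - norm (qIm y))\<^sup>2 \<le> (norm (qIm x - qIm y))\<^sup>2"
    by (metis abs_le_square_iff abs_norm_cancel)
  then show "(dist (slice_coord x) (slice_coord y))\<^sup>2 \<le> (dist x y)\<^sup>2"
    unfolding dist_norm cmod_power2 by (simp add: norm_quat_sq slice_coord_def)
qed simp

lemma slice_coord_mem_ball: "x \<in> ball y r \<Longrightarrow> slice_coord x \<in> ball (slice_coord y) r"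
  using dist_slice_coord_le[of y x] by simp

lemma slice_pt_inj_pair:
  assumes "a + I * b = c + I * d" "a + J * b = c + J * (d :: quat)" "I \<noteq> J"
  shows "a = c" "b = d"
proof -
  have "(a + I * b) - (a + J * b) = (c + I * d) - (c + J * d)" using assms(1,2) by simp
  then have "(I - J) * (b - d) = 0" by (simp add: algebra_simps)
  then show "b = d" using assms(3) by simp
  then show "a = c" using assms(1) by simp
qed

text \<open>On a second slice through a nearby unit both representations still hold around
  \<open>z\<close>, and two slices determine the stem.\<close>

lemma stems_agree:
  assumes "open D" "open V" "open D'" "open V'"
    and F: "\<And>z J. z \<in> D \<Longrightarrow> J \<in> \<S>\<^sub>H \<Longrightarrow> slice_pt J z \<in> V \<Longrightarrow> f (slice_pt J z) = fst (F z) + J * snd (F z)"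
    and F': "\<And>z J. z \<in> D' \<Longrightarrow> J \<in> \<S>\<^sub>H \<Longrightarrow> slice_pt J z \<in> V' \<Longrightarrow> f (slice_pt J z) = fst (F' z) + J * snd (F' z)"
    and z: "z \<in> D" "z \<in> D'" and J: "J \<in> \<S>\<^sub>H" "slice_pt J z \<in> V" "slice_pt J z \<in> V'"
  shows "\<forall>\<^sub>F w in nhds z. F w = F' w"
proof -
  obtain I where I: "I \<in> \<S>\<^sub>H" "I \<noteq> J" "slice_pt I z \<in> V \<inter> V'"
    using nearby_slice[of "V \<inter> V'" J z] assms by blast
  have pre: "open (slice_pt K -` (V \<inter> V'))" for K
    by (intro open_vimage open_Int assms linear_continuous_on bounded_linear_slice_pt)
  define W where "W = (D \<inter> D') \<inter> (slice_pt I -` (V \<inter> V') \<inter> slice_pt J -` (V \<inter> V'))"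
  have "open W" unfolding W_def by (intro open_Int assms pre[unfolded vimage_Int] pre)
  moreover have "z \<in> W" unfolding W_def using z I J by auto
  moreover have "F w = F' w" if "w \<in> W" for w
  proof -
    have "w \<in> D" "w \<in> D'" "slice_pt I w \<in> V" "slice_pt I w \<in> V'" "slice_pt J w \<in> V" "slice_pt J w \<in> V'"
      using that by (auto simp: W_def)
    then have e: "fst (F w) + I * snd (F w) = fst (F' w) + I * snd (F' w)"
      "fst (F w) + J * snd (F w) = fst (F' w) + J * snd (F' w)"
      using F[of w I] F'[of w I] F[of w J] F'[of w J] I(1) J(1) by simp_all
    show ?thesis using slice_pt_inj_pair[OF e I(2)] by (simp add: prod_eq_iff)
  qed
  ultimately show ?thesis unfolding eventually_nhds by blast
qed

lemma cq_norm_identity: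
  assumes "open D" "connected D" "stem_holomorphic_on D F" "z \<in> D" "w \<in> D"
    and "\<forall>\<^sub>F w in nhds z. cq_norm (F w - (c, 0)) = 0"
  shows "cq_norm (F w - (c, 0)) = 0"
proof -
  obtain U where U: "open U" "z \<in> U" "\<And>w. w \<in> U \<Longrightarrow> cq_norm (F w - (c, 0)) = 0"
    using assms(6) unfolding eventually_nhds by blast
  have "open (U \<inter> D)" "z \<in> U \<inter> D" using U assms by auto
  then have "z islimpt (U \<inter> D)" by (metis interior_limit_point interior_open)
  from analytic_continuation[OF cq_norm_holomorphic[OF assms(1,3), of c] assms(1,2) _ assms(4) this _ assms(5)]
  show ?thesis using U(3) by simp
qed

section \<open>Normal functions in terms of the norm form\<close>

lemma cq_norm_cq_bar: "cq_norm (cq_bar w) = cnj (cq_norm w)"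
  by (simp add: cq_norm_def cq_bar_def complex_eq_iff)

lemma stem_on_real: assumes "stem_on D F" "z \<in> D" "Im z = 0" shows "snd (F z) = 0"
proof -
  have "cnj z = z" using assms(3) by (simp add: complex_eq_iff)
  then have "F z = cq_bar (F z)" using assms by (metis stem_on_def)
  then have "snd (F z) = - snd (F z)" by (metis cq_bar_def snd_conv)
  then show ?thesis by (simp add: quat_eq_iff)
qed

text \<open>The stem function is unique, so the choice made in \<^const>\<open>normal_function\<close> is irrelevant.\<close>

lemma normal_function_eq:
  fixes c :: quat
  assumes D: "open D" "cnj ` D = D" and F: "stem_on D F" and g: "\<And>x. x \<in> circularization D \<Longrightarrow> g x = slice_map F x"
    and x: "x \<in> circularization D"
  defines "n \<equiv> cq_norm (F (slice_coord x) - (c, 0))"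
  shows "normal_function (circularization D) (\<lambda>x. g x - c) x = of_real (Re n) + sgn (qIm x) * of_real (Im n)"
proof -
  let ?G = "circularization D" and ?P = "\<lambda>F'. \<exists>D'. induces D' F' (circularization D) (\<lambda>x. g x - c)"
  have "induces D (\<lambda>z. F z - (c, 0)) ?G (\<lambda>x. g x - c)"
    unfolding induces_def
  proof (intro conjI D refl ballI)
    show "stem_on D (\<lambda>z. F z - (c, 0))"
      using F by (auto simp: stem_on_def cq_bar_def prod_eq_iff)
    fix x assume "x \<in> ?G"
    then show "g x - c = slice_map (\<lambda>z. F z - (c, 0)) x"
      by (simp add: g slice_map_def Let_def algebra_simps)
  qed
  then have "?P (SOME F'. ?P F')" by (intro someI_ex[of ?P]) blast
  then obtain D' where D': "induces D' (SOME F'. ?P F') ?G (\<lambda>x. g x - c)" by blast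
  define F' where "F' = (SOME F'. ?P F')"
  have F': "cnj ` D' = D'" "?G = circularization D'" "stem_on D' F'" "\<And>x. x \<in> ?G \<Longrightarrow> g x - c = slice_map F' x"
    using D'[folded F'_def] unfolding induces_def by auto
  let ?z = "slice_coord x"
  have z: "?z \<in> D" "?z \<in> D'"
    using x F'(2) circularization_slice_coord[OF D(2)] circularization_slice_coord[OF F'(1)] by auto
  \<comment> \<open>Both stems give the same values of \<open>g - c\<close> on the sphere over
    \<open>?z\<close>; the units \<open>qi\<close> and \<open>- qi\<close> then separate the two
    components.\<close>
  have "fst (F' ?z) + J * snd (F' ?z) = (fst (F ?z) - c) + J * snd (F ?z)" if J: "J \<in> \<S>\<^sub>H" for J
  proof -
    have "slice_pt J ?z \<in> ?G" unfolding circularization_eq using z J by blast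
    then show ?thesis
      using F'(4) g slice_map_slice_pt[OF F z(1) J] slice_map_slice_pt[OF F'(3) z(2) J]
      by (metis diff_add_eq)
  qed
  note e = this[OF qi_imag_unit] this[OF imag_units_uminus[OF qi_imag_unit]]
  have "qi \<noteq> - qi" by (simp add: qi_def quat_eq_iff)
  then have "F' ?z = F ?z - (c, 0)"
    using slice_pt_inj_pair[OF e] by (simp add: prod_eq_iff)
  then show ?thesis
    unfolding normal_function_def Let_def F'_def[symmetric] n_def
    by (simp add: slice_map_def Let_def cq_mult_conj slice_coord_def[symmetric])
qed

text \<open>On the closed upper half-plane the point over \<open>z\<close> in the slice of
  \<open>qi\<close> is tested; the lower half-plane follows from the symmetry of the stem.\<close>

lemma normal_function_zeroD:
  assumes D: "open D" "cnj ` D = D" and F: "stem_on D F" and g: "\<And>x. x \<in> circularization D \<Longrightarrow> g x = slice_map F x"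
    and zero: "\<And>x. x \<in> circularization D \<Longrightarrow> normal_function (circularization D) (\<lambda>x. g x - c) x = 0"
    and z: "z \<in> D"
  shows "cq_norm (F z - (c, 0)) = 0"
proof -
  have nonneg: "cq_norm (F w - (c, 0)) = 0" if w: "w \<in> D" "Im w \<ge> 0" for w
  proof -
    have x: "slice_pt qi w \<in> circularization D" unfolding circularization_eq using w(1) qi_imag_unit by blast
    define n where "n = cq_norm (F w - (c, 0))"
    have "of_real (Re n) + sgn (Im w *\<^sub>R qi) * of_real (Im n) = (0 :: quat)"
      using normal_function_eq[OF D F g x, of c] zero[OF x] w(2)
      by (simp add: slice_coord_slice_pt qIm_slice_pt n_def)
    \<comment> \<open>At real points the unit is \<open>sgn 0 = 0\<close>, which hides the imaginary
      part, so its vanishing comes from the stem condition.\<close>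
    moreover have "Im n = 0" if "Im w = 0"
      using stem_on_real[OF F w(1) that] by (simp add: n_def cq_norm_def)
    moreover have "sgn (Im w *\<^sub>R qi) = qi" if "Im w > 0"
      using that imag_unitsD(2)[OF qi_imag_unit] by (simp add: sgn_div_norm)
    ultimately show ?thesis
      using w(2) unfolding n_def[symmetric]
      by (cases "Im w = 0") (auto simp: complex_eq_iff quat_eq_iff qi_def)
  qed
  show ?thesis
  proof (cases "Im z \<ge> 0")
    case True
    then show ?thesis using nonneg z by blast
  next
    case False
    have c: "cnj z \<in> D" using z D(2) by blast
    have "F z = cq_bar (F (cnj z))" using F c by (metis complex_cnj_cnj stem_on_def)
    then have "F z - (c, 0) = cq_bar (F (cnj z) - (c, 0))" by (simp add: cq_bar_def prod_eq_iff)
    then show ?thesis using nonneg[OF c] False by (simp add: cq_norm_cq_bar)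
  qed
qed

section \<open>Wings in terms of the norm form\<close>

lemma local_extension_stem:
  assumes "local_extension \<Omega> f y (V, g)"
  obtains D F where "open D" "cnj ` D = D" "symmetric_completion V = circularization D"
    "stem_on D F" "stem_holomorphic_on D F" "\<And>x. x \<in> circularization D \<Longrightarrow> g x = slice_map F x"
    "\<And>x. x \<in> V \<Longrightarrow> slice_coord x \<in> D"
    "\<And>z J. z \<in> D \<Longrightarrow> J \<in> \<S>\<^sub>H \<Longrightarrow> slice_pt J z \<in> V \<Longrightarrow> f (slice_pt J z) = fst (F z) + J * snd (F z)"
proof -
  have g: "\<And>x. x \<in> V \<Longrightarrow> g x = f x" using assms by (auto simp: local_extension_def)
  obtain D F where D: "induces D F (symmetric_completion V) g" "stem_holomorphic_on D F"
    using assms by (auto simp: local_extension_def slice_regular_on_def)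
  then have *: "open D" "cnj ` D = D" "symmetric_completion V = circularization D" "stem_on D F"
    "\<And>x. x \<in> circularization D \<Longrightarrow> g x = slice_map F x"
    by (auto simp: induces_def)
  have V: "x \<in> V \<Longrightarrow> x \<in> circularization D" for x
    using *(3) symmetric_completion_eq by blast
  show thesis
  proof (rule that[OF *(1-4) D(2) *(5)])
    show "x \<in> V \<Longrightarrow> slice_coord x \<in> D" for x using V circularization_slice_coord[OF *(2)] by blast
    fix z J assume a: "z \<in> D" "J \<in> \<S>\<^sub>H" "slice_pt J z \<in> V"
    have "f (slice_pt J z) = g (slice_pt J z)" using g a by simp
    then show "f (slice_pt J z) = fst (F z) + J * snd (F z)"
      using *(5)[OF V[OF a(3)]] slice_map_slice_pt[OF *(4) a(1,2)] by simp
  qed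
qed

lemma stem_rep_agree_extension:
  assumes "stem_rep f V0 D0 F0" "x \<in> V0" "slice_coord x \<in> D0" "open D" "open V" "x \<in> V" "slice_coord x \<in> D"
    "\<And>z J. z \<in> D \<Longrightarrow> J \<in> \<S>\<^sub>H \<Longrightarrow> slice_pt J z \<in> V \<Longrightarrow> f (slice_pt J z) = fst (F z) + J * snd (F z)"
  shows "\<forall>\<^sub>F w in nhds (slice_coord x). F0 w = F w"
proof (rule stems_agree[of D0 V0 D V f F0 F])
  show "open D0" "open V0" using assms(1) by (auto simp: stem_rep_def)
  show "f (slice_pt J z) = fst (F0 z) + J * snd (F0 z)" if "z \<in> D0" "J \<in> \<S>\<^sub>H" "slice_pt J z \<in> V0" for z J
    by (rule stem_rep_zero(1)[OF assms(1) that])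
  show "slice_pt (slice_unit x) (slice_coord x) \<in> V0" "slice_pt (slice_unit x) (slice_coord x) \<in> V"
    using assms by (simp_all add: slice_pt_unit_coord)
qed (use assms slice_unit_in_imag_units in auto)

text \<open>A wing lies in its fibre, so its value is \<open>f x\<close>. The vanishing norm form of
  the extension agrees with that of \<open>F0\<close> near \<open>slice_coord x\<close>, and the
  identity theorem spreads it over \<open>D0\<close>.\<close>

lemma wing_imp_cq_norm_zero:
  assumes "local_extension \<Omega> f y (V, g)" and f: "continuous_on \<Omega> f"
    and x: "x \<in> slice_wings (symmetric_completion V) g \<inter> V"
    and rep: "stem_rep f V0 D0 F0" "connected D0" "x \<in> V0" "slice_coord x \<in> D0" and w: "w \<in> D0"
  shows "cq_norm (F0 w - (f x, 0)) = 0"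
proof -
  have V: "open V" "V \<subseteq> \<Omega>" and g: "\<And>x. x \<in> V \<Longrightarrow> g x = f x"
    using assms(1) by (auto simp: local_extension_def)
  obtain D F where D: "open D" "cnj ` D = D" "symmetric_completion V = circularization D"
    "stem_on D F" "stem_holomorphic_on D F" "\<And>x. x \<in> circularization D \<Longrightarrow> g x = slice_map F x"
    "\<And>x. x \<in> V \<Longrightarrow> slice_coord x \<in> D"
    "\<And>z J. z \<in> D \<Longrightarrow> J \<in> \<S>\<^sub>H \<Longrightarrow> slice_pt J z \<in> V \<Longrightarrow> f (slice_pt J z) = fst (F z) + J * snd (F z)"
    by (rule local_extension_stem[OF assms(1)]) (rule that)
  obtain c where c: "\<And>x. x \<in> circularization D \<Longrightarrow> normal_function (circularization D) (\<lambda>x. g x - c) x = 0"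
    and xc: "x \<in> wing (symmetric_completion V) g c"
    using x D(3) by (auto simp: slice_wings_def)
  have "f x = c"
  proof (rule ccontr)
    assume "f x \<noteq> c"
    \<comment> \<open>Otherwise this neighbourhood of \<open>x\<close> would avoid the fibre,
      whereas \<open>x\<close> is in the closure of a part of the fibre.\<close>
    have "open (V \<inter> f -` (- {c}))"
      by (intro continuous_open_preimage continuous_on_subset[OF f V(2)] V) auto
    moreover have "V \<subseteq> symmetric_completion V" using symmetric_completion_eq by blast
    ultimately have "openin (top_of_set (symmetric_completion V)) (V \<inter> f -` (- {c}))"
      by (intro open_subset) auto
    moreover have "x \<in> V \<inter> f -` (- {c})" using x \<open>f x \<noteq> c\<close> by auto
    moreover have "\<forall>T. x \<in> T \<and> openin (top_of_set (symmetric_completion V)) T \<longrightarrow> (\<exists>x'. g x' = c \<and> x' \<in> T)"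
      using xc unfolding wing_def in_closure_of by blast
    ultimately obtain x' where "x' \<in> V \<inter> f -` (- {c})" "g x' = c" by meson
    then show False using g by auto
  qed
  have z: "\<And>z. z \<in> D \<Longrightarrow> cq_norm (F z - (c, 0)) = 0"
    using normal_function_zeroD[OF D(1,2,4,6) c] .
  have "slice_coord x \<in> D" "x \<in> V" using x D(7) by auto
  then have "\<forall>\<^sub>F w in nhds (slice_coord x). F0 w = F w"
    using stem_rep_agree_extension[OF rep(1,3,4) D(1) V(1) _ _ D(8)] by blast
  moreover have "\<forall>\<^sub>F w in nhds (slice_coord x). w \<in> D"
    using D(1) \<open>slice_coord x \<in> D\<close> by (rule eventually_nhds_in_open)
  ultimately have "\<forall>\<^sub>F w in nhds (slice_coord x). cq_norm (F0 w - (c, 0)) = 0"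
    by eventually_elim (simp add: z)
  then show ?thesis
    unfolding \<open>f x = c\<close> using rep w by (intro cq_norm_identity[of D0 F0 "slice_coord x" w c]) (auto simp: stem_rep_def)
qed

lemma dbar_cong_open:
  assumes "open V" "x \<in> V" "\<And>x. x \<in> V \<Longrightarrow> g x = f x" "(f has_derivative L) (at x)"
  shows "dbar g x = dbar f x"
proof -
  have "(g has_derivative L) (at x)"
    by (rule has_derivative_transform_within_open[OF assms(4,1,2)]) (simp add: assms)
  then show ?thesis using dbar_eq assms(4) by metis
qed

text \<open>The vanishing spreads to all points of the connected set \<open>V\<close>, hence to its
  symmetric completion, so the normal function is zero. Being nondegenerate, \<open>x\<close>
  belongs to the set whose closure is the wing.\<close>

lemma cq_norm_zero_imp_wing:
  assumes ext: "local_extension \<Omega> f y (V, g)" and f: "f \<in> SR_loc \<Omega>" and x: "x \<in> V" "dbar f x \<noteq> 0"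
    and rep: "stem_rep f V0 D0 F0" "x \<in> V0" "slice_coord x \<in> D0"
    and zero: "\<And>w. w \<in> D0 \<Longrightarrow> cq_norm (F0 w - (f x, 0)) = 0"
  shows "x \<in> slice_wings (symmetric_completion V) g \<inter> V"
proof -
  have V: "open V" "V \<subseteq> \<Omega>" "connected V" and g: "\<And>x. x \<in> V \<Longrightarrow> g x = f x"
    using ext by (auto simp: local_extension_def)
  obtain D F where D: "open D" "cnj ` D = D" "symmetric_completion V = circularization D"
    "stem_on D F" "stem_holomorphic_on D F" "\<And>x. x \<in> circularization D \<Longrightarrow> g x = slice_map F x"
    "\<And>x. x \<in> V \<Longrightarrow> slice_coord x \<in> D"
    "\<And>z J. z \<in> D \<Longrightarrow> J \<in> \<S>\<^sub>H \<Longrightarrow> slice_pt J z \<in> V \<Longrightarrow> f (slice_pt J z) = fst (F z) + J * snd (F z)"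
    by (rule local_extension_stem[OF ext]) (rule that)
  define c where "c = f x"
  \<comment> \<open>Vanishing as a germ is locally constant by the identity theorem. The argument
    runs along \<open>V\<close> because \<open>D\<close> may fall into two conjugate halves.\<close>
  define P where "P = (\<lambda>v. \<forall>\<^sub>F w in nhds (slice_coord v). cq_norm (F w - (c, 0)) = 0)"
  have "P constant_on V"
  proof (rule locally_constant_imp_constant[OF V(3)])
    fix a assume a: "a \<in> V"
    then obtain e where e: "e > 0" "ball (slice_coord a) e \<subseteq> D"
      using D(1,7) open_contains_ball by blast
    have hol: "stem_holomorphic_on (ball (slice_coord a) e) F"
      using D(5) e(2) by (auto simp: stem_holomorphic_on_def)
    have *: "P u \<longleftrightarrow> (\<forall>w\<in>ball (slice_coord a) e. cq_norm (F w - (c, 0)) = 0)" if "u \<in> ball a e" for u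
    proof
      assume "P u"
      then show "\<forall>w\<in>ball (slice_coord a) e. cq_norm (F w - (c, 0)) = 0"
        using cq_norm_identity[OF open_ball connected_ball hol slice_coord_mem_ball[OF that]] unfolding P_def by blast
    next
      assume "\<forall>w\<in>ball (slice_coord a) e. cq_norm (F w - (c, 0)) = 0"
      then show "P u" unfolding P_def eventually_nhds
        using slice_coord_mem_ball[OF that] open_ball by blast
    qed
    show "\<exists>T. openin (top_of_set V) T \<and> a \<in> T \<and> (\<forall>x\<in>T. P x = P a)"
      using a e(1) * by (intro exI[of _ "V \<inter> ball a e"]) (auto simp: openin_open_Int)
  qed
  moreover have "P x"
  proof -
    have "\<forall>\<^sub>F w in nhds (slice_coord x). F0 w = F w"
      using stem_rep_agree_extension[OF rep D(1) V(1) x(1) D(7)[OF x(1)] D(8)] .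
    moreover have "\<forall>\<^sub>F w in nhds (slice_coord x). w \<in> D0"
      using rep by (intro eventually_nhds_in_open) (auto simp: stem_rep_def)
    ultimately show ?thesis unfolding P_def
      by eventually_elim (metis zero c_def)
  qed
  ultimately have "P v" if "v \<in> V" for v using x(1) that unfolding constant_on_def by metis
  then have zV: "cq_norm (F (slice_coord v) - (c, 0)) = 0" if "v \<in> V" for v
    using that eventually_nhds_x_imp_x unfolding P_def by blast
  have "normal_function (circularization D) (\<lambda>x. g x - c) u = 0" if u: "u \<in> circularization D" for u
  proof -
    have "slice_coord u \<in> slice_coord ` V" using u D(3) symmetric_completion_eq by blast
    then have "cq_norm (F (slice_coord u) - (c, 0)) = 0" using zV by auto
    then show ?thesis using normal_function_eq[OF D(1,2,4,6) u, of c] by simp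
  qed
  moreover have "x \<in> wing (symmetric_completion V) g c"
  proof -
    obtain L where L: "(f has_derivative L) (at x)" using SR_loc_derivative[OF f] x(1) V(2) by blast
    have "dbar g x \<noteq> 0" using dbar_cong_open[OF V(1) x(1) g L] x(2) by simp
    moreover have "x \<in> symmetric_completion V" using x(1) symmetric_completion_eq by blast
    ultimately show ?thesis
      unfolding wing_def using g[OF x(1)] x(1)
      by (intro subsetD[OF closure_of_subset_Int]) (auto simp: c_def degenerate_set_def)
  qed
  ultimately show ?thesis using x(1) D(3) by (auto simp: slice_wings_def)
qed

subsection \<open>Existence of local extensions\<close>

text \<open>\<open>D\<close> and its conjugate lie in opposite open half-planes, so the reflected
  function needs no matching along the real axis.\<close>

lemma stem_reflection:
  assumes D: "stem_holomorphic_on D F" and pos: "\<And>z. z \<in> D \<Longrightarrow> Im z > 0" and "open D"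
  defines "F' \<equiv> \<lambda>z. if Im z > 0 then F z else cq_bar (F (cnj z))"
  shows "stem_on (D \<union> cnj ` D) F'" "stem_holomorphic_on (D \<union> cnj ` D) F'"
proof -
  have bar_bar: "cq_bar (cq_bar w) = w" for w by (simp add: cq_bar_def)
  show "stem_on (D \<union> cnj ` D) F'"
    unfolding stem_on_def
  proof
    fix z assume "z \<in> D \<union> cnj ` D"
    then consider "Im z > 0" | "Im z < 0" using pos by fastforce
    then show "F' (cnj z) = cq_bar (F' z)"
      by cases (simp_all add: F'_def bar_bar)
  qed
  have bar: "bounded_linear cq_bar"
    unfolding cq_bar_def[abs_def]
    by (intro bounded_linear_Pair bounded_linear_fst bounded_linear_minus bounded_linear_snd)
  show "stem_holomorphic_on (D \<union> cnj ` D) F'"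
    unfolding stem_holomorphic_on_def
  proof
    fix z assume "z \<in> D \<union> cnj ` D"
    then consider "z \<in> D" | "cnj z \<in> D" by auto
    then show "\<exists>G. (F' has_derivative G) (at z) \<and> (\<forall>v. G (\<i> * v) = cq_iota (G v))"
    proof cases
      case 1
      then obtain G where G: "(F has_derivative G) (at z)" "\<forall>v. G (\<i> * v) = cq_iota (G v)"
        using D unfolding stem_holomorphic_on_def by blast
      have "(F' has_derivative G) (at z)"
        by (rule has_derivative_transform_within_open[OF G(1) assms(3) 1]) (simp add: F'_def pos)
      with G(2) show ?thesis by blast
    next
      case 2
      then obtain G where G: "(F has_derivative G) (at (cnj z))" "\<And>v. G (\<i> * v) = cq_iota (G v)"
        using D unfolding stem_holomorphic_on_def by blast
      have "((\<lambda>z. F (cnj z)) has_derivative (\<lambda>v. G (cnj v))) (at z)"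
        by (rule has_derivative_compose[OF bounded_linear_imp_has_derivative[OF bounded_linear_cnj] G(1)])
      then have "((\<lambda>z. cq_bar (F (cnj z))) has_derivative (\<lambda>v. cq_bar (G (cnj v)))) (at z)"
        by (rule bounded_linear.has_derivative[OF bar])
      moreover have "open (cnj -` D)" by (intro open_vimage assms(3) linear_continuous_on bounded_linear_cnj)
      moreover have "z \<in> cnj -` D" using 2 by simp
      ultimately have "(F' has_derivative (\<lambda>v. cq_bar (G (cnj v)))) (at z)"
      proof (rule has_derivative_transform_within_open)
        fix w assume "w \<in> cnj -` D"
        then have "Im w < 0" using pos[of "cnj w"] by simp
        then show "cq_bar (F (cnj w)) = F' w" by (simp add: F'_def)
      qed
      moreover have "cq_bar (G (cnj (\<i> * v))) = cq_iota (cq_bar (G (cnj v)))" for v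
      proof -
        \<comment> \<open>Conjugation reverses the sign of the imaginary unit, and
          \<open>cq_bar\<close> reverses it back.\<close>
        have "G (cnj (\<i> * v)) = G (- (\<i> * cnj v))" by simp
        also have "\<dots> = - cq_iota (G (cnj v))"
          using linear_neg[OF has_derivative_linear[OF G(1)]] G(2) by metis
        finally show ?thesis by (simp add: cq_bar_def cq_iota_def)
      qed
      ultimately show ?thesis by blast
    qed
  qed
qed

lemma good_ball:
  assumes "open \<Omega>" "f \<in> SR_loc \<Omega>" "y \<in> \<Omega>"
  obtains r F where "r > 0" "ball y r \<subseteq> \<Omega>" "Im (slice_coord y) = 0 \<or> r \<le> Im (slice_coord y)"
    "stem_rep f (ball y r) (ball (slice_coord y) r) F"
proof -
  obtain e where e: "e > 0" "ball y e \<subseteq> \<Omega>" using assms(1,3) open_contains_ball by blast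
  define r where "r = (if Im (slice_coord y) = 0 then e else min e (Im (slice_coord y)))"
  have r: "r > 0" "r \<le> e" "Im (slice_coord y) = 0 \<or> r \<le> Im (slice_coord y)"
    using e(1) Im_slice_coord_nonneg[of y] by (auto simp: r_def)
  then have "ball y r \<subseteq> \<Omega>" using e(2) by auto
  then show thesis using stem_rep_ball[OF assms(1,2) _ r(1,3)] r that by blast
qed

text \<open>For a real centre the disc is symmetric and \<open>F\<close> is already a stem function;
  for any other centre the disc lies in the open upper half-plane and \<open>F\<close> is
  reflected.\<close>

lemma local_extension_exists:
  assumes "open \<Omega>" "f \<in> SR_loc \<Omega>" "y \<in> \<Omega>"
  shows "\<exists>p. local_extension \<Omega> f y p"
proof -
  obtain r F where r: "r > 0" "ball y r \<subseteq> \<Omega>" "Im (slice_coord y) = 0 \<or> r \<le> Im (slice_coord y)"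
    and rep: "stem_rep f (ball y r) (ball (slice_coord y) r) F"
    by (rule good_ball[OF assms])
  define V D0 where "V = ball y r" and "D0 = ball (slice_coord y) r"
  have hol: "stem_holomorphic_on D0 F" using rep by (simp add: stem_rep_def D0_def)
  have pV: "slice_coord x \<in> D0" if "x \<in> V" for x using slice_coord_mem_ball that by (auto simp: V_def D0_def)
  have D0V: "slice_pt (slice_unit y) z \<in> V" if "z \<in> D0" for z using slice_pt_mem_ball that
    by (auto simp: V_def D0_def)
  note rep0 = stem_rep_zero[OF rep[folded V_def D0_def]]
  \<comment> \<open>The conditions on \<open>D0\<close> say that \<open>D\<close> and
    \<open>D0\<close> have the same points in the closed upper half-plane, which identifies the
    symmetric completion of \<open>V\<close> with the circularization of \<open>D\<close>.\<close>
  have "\<exists>D F'. open D \<and> cnj ` D = D \<and> stem_on D F' \<and> stem_holomorphic_on D F' \<and> D0 \<subseteq> D \<and>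
    D \<inter> {z. Im z \<ge> 0} \<subseteq> D0 \<and> (\<forall>z\<in>D0. Im z \<ge> 0 \<longrightarrow> F' z = F z)"
  proof (cases "Im (slice_coord y) = 0")
    case True
    then have cy: "cnj (slice_coord y) = slice_coord y" by (simp add: complex_eq_iff)
    have yJ: "slice_pt J (slice_coord y) = y" for J
      using slice_pt_unit_coord[of y] True by (simp add: slice_pt_real)
    have all: "slice_pt J z \<in> V" if "J \<in> \<S>\<^sub>H" "z \<in> D0" for J z
      using dist_slice_pt[OF that(1), of "slice_coord y" z] that(2) by (simp add: yJ V_def D0_def)
    have cD0: "cnj z \<in> D0" if "z \<in> D0" for z
      using that cy complex_mod_cnj[of "slice_coord y - z"] by (simp add: D0_def dist_norm)
    have "cnj ` D0 = D0"
      using cD0 by (metis complex_cnj_cnj image_eqI image_subsetI subsetI subset_antisym)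
    moreover have "stem_on D0 F"
      unfolding stem_on_def
    proof
      fix z assume z: "z \<in> D0"
      \<comment> \<open>The same quaternion is evaluated over \<open>cnj z\<close> with unit
        \<open>J\<close> and over \<open>z\<close> with unit \<open>- J\<close>.\<close>
      have *: "fst (F (cnj z)) + J * snd (F (cnj z)) = fst (F z) + J * (- snd (F z))" if J: "J \<in> \<S>\<^sub>H" for J
        using rep0(1)[OF cD0[OF z] J all[OF J cD0[OF z]]]
          rep0(1)[OF z imag_units_uminus[OF J] all[OF imag_units_uminus[OF J] z]]
        by (simp add: slice_pt_uminus)
      have "qi \<noteq> - qi" by (simp add: qi_def quat_eq_iff)
      then show "F (cnj z) = cq_bar (F z)"
        using slice_pt_inj_pair[OF *[OF qi_imag_unit] *[OF imag_units_uminus[OF qi_imag_unit]]]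
        by (simp add: cq_bar_def prod_eq_iff)
    qed
    ultimately show ?thesis using hol by (intro exI[of _ D0] exI[of _ F]) (auto simp: D0_def)
  next
    case False
    then have pos: "Im z > 0" if "z \<in> D0" for z
      using that r(3) abs_Im_le_cmod[of "slice_coord y - z"] by (simp add: D0_def dist_norm)
    have "open D0" by (simp add: D0_def)
    note refl = stem_reflection[OF hol pos this]
    have "cnj ` D0 = cnj -` D0"
      by (auto simp: image_iff) (metis complex_cnj_cnj)
    then have "open (D0 \<union> cnj ` D0)"
      using \<open>open D0\<close> by (simp add: open_Un open_vimage linear_continuous_on bounded_linear_cnj)
    moreover have "cnj ` (D0 \<union> cnj ` D0) = D0 \<union> cnj ` D0"
      by (auto simp: image_Un image_image)
    moreover have "(D0 \<union> cnj ` D0) \<inter> {z. Im z \<ge> 0} \<subseteq> D0"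
      using pos by force
    ultimately show ?thesis
      using refl pos
      by (intro exI[of _ "D0 \<union> cnj ` D0"] exI[of _ "\<lambda>z. if Im z > 0 then F z else cq_bar (F (cnj z))"]) auto
  qed
  then obtain D F' where D: "open D" "cnj ` D = D" "stem_on D F'" "stem_holomorphic_on D F'" "D0 \<subseteq> D"
    "D \<inter> {z. Im z \<ge> 0} \<subseteq> D0" "\<And>z. z \<in> D0 \<Longrightarrow> Im z \<ge> 0 \<Longrightarrow> F' z = F z"
      by blast
  have "slice_coord x \<in> slice_coord ` V \<longleftrightarrow> slice_coord x \<in> D" for x
  proof
    assume "slice_coord x \<in> D"
    then have "slice_coord x \<in> D0" using D(6) Im_slice_coord_nonneg by blast
    then have "slice_pt (slice_unit y) (slice_coord x) \<in> V" by (rule D0V)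
    moreover have "slice_coord (slice_pt (slice_unit y) (slice_coord x)) = slice_coord x"
      by (simp add: slice_coord_slice_pt slice_unit_in_imag_units Im_slice_coord_nonneg)
    ultimately show "slice_coord x \<in> slice_coord ` V" by (metis imageI)
  qed (use pV D(5) in auto)
  then have "symmetric_completion V = circularization D"
    using symmetric_completion_eq circularization_slice_coord[OF D(2)] by blast
  then have "induces D F' (symmetric_completion V) (slice_map F')"
    using D by (simp add: induces_def)
  then have "slice_regular_on (symmetric_completion V) (slice_map F')"
    using D(4) unfolding slice_regular_on_def by blast
  moreover have "slice_map F' x = f x" if x: "x \<in> V" for x
  proof -
    have "f (slice_pt (slice_unit x) (slice_coord x)) = fst (F (slice_coord x)) + slice_unit x * snd (F (slice_coord x))"
      by (rule rep0(1)[OF pV[OF x] slice_unit_in_imag_units]) (simp add: slice_pt_unit_coord x)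
    moreover have "slice_map F' (slice_pt (slice_unit x) (slice_coord x)) = fst (F' (slice_coord x)) + slice_unit x * snd (F' (slice_coord x))"
      using D(5) pV[OF x] by (intro slice_map_slice_pt[OF D(3) _ slice_unit_in_imag_units]) blast
    ultimately show ?thesis
      using D(7)[OF pV[OF x] Im_slice_coord_nonneg] by (simp add: slice_pt_unit_coord)
  qed
  ultimately have "local_extension \<Omega> f y (V, slice_map F')"
    using r by (simp add: local_extension_def V_def)
  then show ?thesis by blast
qed

subsection \<open>Openness away from degenerate points and wings\<close>

lemma wing_set_eq:
  "wing_set \<Omega> f = (\<Union>y\<in>\<Omega>. let p = SOME p. local_extension \<Omega> f y p
     in slice_wings (symmetric_completion (fst p)) (snd p) \<inter> fst p)"
  by (simp add: wing_set_def Let_def case_prod_unfold)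

lemma wing_setD:
  assumes "open \<Omega>" "f \<in> SR_loc \<Omega>" "x \<in> wing_set \<Omega> f"
  shows "\<exists>y V g. local_extension \<Omega> f y (V, g) \<and> x \<in> slice_wings (symmetric_completion V) g \<inter> V"
proof -
  obtain y where y: "y \<in> \<Omega>" and x: "x \<in> (let p = SOME p. local_extension \<Omega> f y p
     in slice_wings (symmetric_completion (fst p)) (snd p) \<inter> fst p)"
    using assms(3) unfolding wing_set_eq by blast
  have "local_extension \<Omega> f y (SOME p. local_extension \<Omega> f y p)"
    using local_extension_exists[OF assms(1,2) y] by (rule someI_ex)
  with x show ?thesis unfolding Let_def by (metis prod.collapse)
qed

lemma not_wing_setD:
  assumes "open \<Omega>" "f \<in> SR_loc \<Omega>" "x \<in> \<Omega>" "x \<notin> wing_set \<Omega> f"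
  shows "\<exists>V g. local_extension \<Omega> f x (V, g) \<and> x \<notin> slice_wings (symmetric_completion V) g \<inter> V"
proof -
  have "x \<notin> (let p = SOME p. local_extension \<Omega> f x p
     in slice_wings (symmetric_completion (fst p)) (snd p) \<inter> fst p)"
    using assms(3,4) unfolding wing_set_eq by blast
  moreover have "local_extension \<Omega> f x (SOME p. local_extension \<Omega> f x p)"
    using local_extension_exists[OF assms(1-3)] by (rule someI_ex)
  ultimately show ?thesis unfolding Let_def by (metis prod.collapse)
qed

lemma continuous_on_dbar:
  assumes "f \<in> SR_loc \<Omega>" shows "continuous_on \<Omega> (dbar f)"
proof -
  obtain f' :: "quat \<Rightarrow> quat \<Rightarrow>\<^sub>L quat" where f': "\<And>x. x \<in> \<Omega> \<Longrightarrow> (f has_derivative blinfun_apply (f' x)) (at x)"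
    "continuous_on \<Omega> f'" using assms unfolding SR_loc_def C1_on_def by blast
  have "continuous_on \<Omega> (\<lambda>x. (f' x 1 + qi * f' x qi + qj * f' x qj + qk * f' x qk) /\<^sub>R 2)"
    by (intro continuous_intros f'(2))
  then show ?thesis
    by (rule continuous_on_eq) (simp add: dbar_eq[OF f'(1)])
qed

text \<open>The contrapositive of \<open>cq_norm_zero_imp_wing\<close>, applied to the extension
  chosen at \<open>x\<close> itself.\<close>

lemma regular_point:
  assumes "open \<Omega>" "f \<in> SR_loc \<Omega>" and x: "x \<in> \<Omega> - (degenerate_set \<Omega> f \<union> wing_set \<Omega> f)"
  obtains r F w where "r > 0" "ball x r \<subseteq> \<Omega>" "stem_rep f (ball x r) (ball (slice_coord x) r) F"
    "w \<in> ball (slice_coord x) r" "cq_norm (F w - (f x, 0)) \<noteq> 0"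
proof -
  have x': "x \<in> \<Omega>" "dbar f x \<noteq> 0" using x by (auto simp: degenerate_set_def)
  obtain r F where r: "r > 0" "ball x r \<subseteq> \<Omega>" and rep: "stem_rep f (ball x r) (ball (slice_coord x) r) F"
    using good_ball[OF assms(1,2) x'(1)] by blast
  obtain V g where ext: "local_extension \<Omega> f x (V, g)" and "x \<notin> slice_wings (symmetric_completion V) g \<inter> V"
    using not_wing_setD[OF assms(1,2) x'(1)] x by blast
  moreover have "x \<in> V" using ext by (simp add: local_extension_def)
  ultimately obtain w where "w \<in> ball (slice_coord x) r" "cq_norm (F w - (f x, 0)) \<noteq> 0"
    using cq_norm_zero_imp_wing[OF ext assms(2) _ x'(2) rep] r(1) by (metis centre_in_ball)
  then show thesis using that r rep by blast
qed

text \<open>For a fixed witness \<open>w\<close>, non-vanishing of the norm form at \<open>w\<close>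
  is an open condition on the value \<open>f u\<close>, and it keeps \<open>u\<close> off every
  wing. Relatively open subsets are therefore open.\<close>

lemma open_regular_points:
  assumes "open \<Omega>" "f \<in> SR_loc \<Omega>"
  shows "open (\<Omega> - (degenerate_set \<Omega> f \<union> wing_set \<Omega> f))" (is "open ?S")
proof (subst open_subopen, intro ballI)
  fix x assume x: "x \<in> ?S"
  obtain r F w where r: "r > 0" "ball x r \<subseteq> \<Omega>" and rep: "stem_rep f (ball x r) (ball (slice_coord x) r) F"
    and w: "w \<in> ball (slice_coord x) r" "cq_norm (F w - (f x, 0)) \<noteq> 0"
    by (rule regular_point[OF assms x])
  have cont: "continuous_on (ball x r) f" "continuous_on (ball x r) (dbar f)"
    using SR_loc_continuous_on[OF assms(2)] continuous_on_dbar[OF assms(2)] r(2) continuous_on_subset by blast+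
  define T where "T = (ball x r \<inter> dbar f -` (- {0})) \<inter> (ball x r \<inter> (\<lambda>u. cq_norm (F w - (f u, 0))) -` (- {0}))"
  have "continuous_on (ball x r) (\<lambda>u. cq_norm (F w - (f u, 0)))"
    by (intro continuous_on_cq_norm continuous_intros cont)
  then have "open T" unfolding T_def
    using cont(2) by (intro open_Int continuous_open_preimage[OF _ open_ball]) auto
  moreover have "x \<in> T" using r(1) w x by (auto simp: T_def degenerate_set_def)
  moreover have "T \<subseteq> ?S"
  proof
    fix u assume u: "u \<in> T"
    then have u': "u \<in> ball x r" "dbar f u \<noteq> 0" "cq_norm (F w - (f u, 0)) \<noteq> 0" by (auto simp: T_def)
    have "u \<notin> wing_set \<Omega> f"
    proof
      assume "u \<in> wing_set \<Omega> f"
      then obtain y V g where y: "local_extension \<Omega> f y (V, g)"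
        "u \<in> slice_wings (symmetric_completion V) g \<inter> V" using wing_setD[OF assms] by blast
      from wing_imp_cq_norm_zero[OF y(1) SR_loc_continuous_on[OF assms(2)] y(2) rep connected_ball u'(1)
          slice_coord_mem_ball[OF u'(1)] w(1)] u'(3)
      show False by simp
    qed
    then show "u \<in> ?S" using u' r(2) by (auto simp: degenerate_set_def)
  qed
  ultimately show "\<exists>T. open T \<and> x \<in> T \<and> T \<subseteq> ?S" by blast
qed

lemma open_map_regular_points:
  assumes "open \<Omega>" "f \<in> SR_loc \<Omega>"
  shows "open_map (top_of_set (\<Omega> - (degenerate_set \<Omega> f \<union> wing_set \<Omega> f))) euclidean f"
  unfolding open_map_def
proof (intro allI impI)
  let ?S = "\<Omega> - (degenerate_set \<Omega> f \<union> wing_set \<Omega> f)"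
  fix U assume "openin (top_of_set ?S) U"
  then have U: "open U" "U \<subseteq> ?S" using openin_open_eq[OF open_regular_points[OF assms]] by auto
  have "f x \<in> interior (f ` U)" if xU: "x \<in> U" for x
  proof -
    have x: "x \<in> ?S" using xU U(2) by blast
    obtain r F w where r: "r > 0" "ball x r \<subseteq> \<Omega>" and rep: "stem_rep f (ball x r) (ball (slice_coord x) r) F"
      and w: "w \<in> ball (slice_coord x) r" "cq_norm (F w - (f x, 0)) \<noteq> 0"
      by (rule regular_point[OF assms x])
    have px: "slice_coord x \<in> ball (slice_coord x) r" using r(1) by simp
    have xx: "slice_pt (slice_unit x) (slice_coord x) = x" by (rule slice_pt_unit_coord)
    show ?thesis
    \<comment> \<open>At a real point \<open>snd F\<close> vanishes whatever \<open>dbar f\<close>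
      is, but the sphere is a single point and the sphere version applies.\<close>
    proof (cases "Im (slice_coord x) = 0")
      case True
      then have "slice_pt J (slice_coord x) = x" for J using xx by (simp add: slice_pt_real)
      then show ?thesis
        using xU r(1) U(1)
          by (intro stem_rep_open_at_sphere[OF rep connected_ball px w _ _ slice_unit_in_imag_units[of x]]) auto
    next
      case False
      have "snd (F (slice_coord x)) = - (Im (slice_coord x) *\<^sub>R dbar f x)"
        using stem_rep_zero(2)[OF rep px slice_unit_in_imag_units[of x]] xx r(1) by simp
      moreover have "dbar f x \<noteq> 0" using x by (auto simp: degenerate_set_def)
      ultimately have "snd (F (slice_coord x)) \<noteq> 0" using False by simp
      then show ?thesis
        using xU r(1) U(1) xx
          by (intro stem_rep_open_at[OF rep connected_ball px w slice_unit_in_imag_units[of x]]) auto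
    qed
  qed
  then have "interior (f ` U) = f ` U"
    by (intro subset_antisym interior_subset) auto
  then show "openin euclidean (f ` U)"
    using open_interior[of "f ` U"] by simp
qed

section \<open>Quasi-openness\<close>

lemma root_path:
  assumes "stem_holomorphic_on D F" "T \<subseteq> D" "\<And>z. z \<in> T \<Longrightarrow> snd (F z) \<noteq> 0"
  shows "continuous_on T (\<lambda>z. slice_pt (- ((fst (F z) - c) * inverse (snd (F z)))) z)"
proof -
  have "continuous_on T F"
    using continuous_on_subset[OF stem_holomorphic_continuous[OF assms(1)] assms(2)] .
  then show ?thesis unfolding slice_pt_def using assms(3) by (intro continuous_intros) auto
qed

lemma root_value:
  assumes "stem_rep f V D F" "z \<in> D" "snd (F z) \<noteq> 0" "cq_norm (F z - (c, 0)) = 0"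
  defines "J \<equiv> - ((fst (F z) - c) * inverse (snd (F z)))"
  shows "J \<in> \<S>\<^sub>H" "slice_pt J z \<in> V \<Longrightarrow> f (slice_pt J z) = c"
proof -
  have J: "J \<in> \<S>\<^sub>H" "fst (F z) - c + J * snd (F z) = 0"
    using cq_norm_root[OF assms(4)] assms(3) by (simp_all add: J_def)
  then show "J \<in> \<S>\<^sub>H" by simp
  show "f (slice_pt J z) = c" if "slice_pt J z \<in> V"
    using stem_rep_zero(1)[OF assms(1,2) J(1) that] J(2) by (simp add: algebra_simps)
qed

text \<open>Compactness of \<open>C\<close> keeps the component of \<open>\<S>\<^bsub>x\<^esub> \<inter> \<Omega>\<close> through a degenerate point \<open>x\<close> from
  leaving \<open>\<Omega>\<close>, so it is closed as well as open in the sphere.\<close>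

lemma degenerate_sphere_subset:
  assumes \<Omega>: "open \<Omega>" "f \<in> SR_loc \<Omega>" and C: "compact C" "C \<subseteq> {x \<in> \<Omega>. f x = c}"
    and maximal: "\<And>T. connected T \<Longrightarrow> T \<subseteq> {x \<in> \<Omega>. f x = c} \<Longrightarrow> T \<inter> C \<noteq> {} \<Longrightarrow> T \<subseteq> C"
    and x: "x \<in> C" "Im (slice_coord x) > 0" "dbar f x = 0" and J: "J \<in> \<S>\<^sub>H"
  shows "slice_pt J (slice_coord x) \<in> C"
proof -
  define z where "z = slice_coord x"
  \<comment> \<open>Degeneracy is part of \<open>P\<close> because it makes \<open>f\<close>
    constant on the nearby part of the sphere, which is how membership in \<open>C\<close>
    spreads.\<close>
  define P where "P = (\<lambda>J. slice_pt J z \<in> C \<and> dbar f (slice_pt J z) = 0)"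
  have pre: "open ((\<lambda>J. slice_pt J z) -` T)" if "open T" for T
    by (rule open_vimage[OF that]) (unfold slice_pt_def, intro continuous_intros)
  have "P constant_on \<S>\<^sub>H"
  proof (rule locally_constant_imp_constant[OF connected_imag_units])
    fix I assume I: "I \<in> \<S>\<^sub>H"
    show "\<exists>T. openin (top_of_set \<S>\<^sub>H) T \<and> I \<in> T \<and> (\<forall>K\<in>T. P K = P I)"
    proof (cases "slice_pt I z \<in> C")
      case False
      have "open (- C)" using C(1) compact_imp_closed by blast
      then show ?thesis
        using False I pre[of "- C"]
        by (intro exI[of _ "\<S>\<^sub>H \<inter> (\<lambda>J. slice_pt J z) -` (- C)"]) (auto simp: P_def openin_open_Int)
    next
      case True
      define y where "y = slice_pt I z"
      have py: "slice_coord y = z" unfolding y_def using x(2) I by (simp add: slice_coord_slice_pt z_def)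
      have y: "y \<in> C" "y \<in> \<Omega>" "f y = c" using True C(2) by (auto simp: y_def)
      obtain r F where r: "r > 0" "ball y r \<subseteq> \<Omega>" "Im (slice_coord y) = 0 \<or> r \<le> Im (slice_coord y)"
        and rep: "stem_rep f (ball y r) (ball (slice_coord y) r) F"
        by (rule good_ball[OF \<Omega> y(2)])
      have z: "z \<in> ball (slice_coord y) r" using r(1) py by simp
      define T where "T = {K \<in> \<S>\<^sub>H. slice_pt K z \<in> ball y r}"
      have "T = \<S>\<^sub>H \<inter> (\<lambda>K. slice_pt K z) -` ball y r" by (auto simp: T_def)
      then have "openin (top_of_set \<S>\<^sub>H) T" by (metis pre open_ball openin_open_Int)
      moreover have IT: "I \<in> T" using I r(1) by (simp add: T_def y_def)
      moreover have "P K = P I" if K: "K \<in> T" for K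
      proof -
        have val: "f (slice_pt L z) = fst (F z) + L * snd (F z)" "snd (F z) = - (Im z *\<^sub>R dbar f (slice_pt L z))"
          if "L \<in> T" for L
          using stem_rep_zero(1,2)[OF rep z] that by (auto simp: T_def)
        have "dbar f (slice_pt K z) = dbar f (slice_pt I z)"
          using val(2)[OF K] val(2)[OF IT] x(2) by (simp add: z_def)
        moreover have "slice_pt K z \<in> C" if d: "dbar f (slice_pt I z) = 0"
        proof -
          have "snd (F z) = 0" using val(2)[OF IT] d by simp
          then have "f (slice_pt L z) = c" if "L \<in> T" for L
            using val(1)[OF that] val(1)[OF IT] y(3) by (simp add: y_def)
          moreover have "connected ((\<lambda>L. slice_pt L z) ` T)"
            unfolding T_def
            by (rule connected_continuous_image[OF _ connected_sphere_ball[OF r(1,3) z]])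
              (unfold slice_pt_def, intro continuous_intros)
          ultimately have "(\<lambda>L. slice_pt L z) ` T \<subseteq> C"
            using r(2) IT True by (intro maximal) (auto simp: T_def)
          then show ?thesis using K by blast
        qed
        ultimately show ?thesis using True by (auto simp: P_def)
      qed
      ultimately show ?thesis by blast
    qed
  qed
  then obtain b where b: "\<And>J. J \<in> \<S>\<^sub>H \<Longrightarrow> P J = b" unfolding constant_on_def by blast
  have "P (slice_unit x)" using x slice_pt_unit_coord[of x] by (simp add: P_def z_def)
  then have "P J" using b[OF J] b[OF slice_unit_in_imag_units[of x]] by simp
  then show ?thesis by (simp add: P_def z_def)
qed

lemma of_real_shift_mem_ball:
  "0 \<le> t \<Longrightarrow> t < r \<Longrightarrow> z + of_real t \<in> ball (z :: complex) r"
  by (simp add: dist_norm)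

text \<open>If the norm form of \<open>F - c\<close> vanishes identically, then a root over \<open>z\<close> continues to roots
  over \<open>z + t\<close>, and a compact component of the fibre cannot have a rightmost point.\<close>

lemma no_rightmost_nondegenerate:
  assumes rep: "stem_rep f V (ball z r) F" "r > 0" "V \<subseteq> \<Omega>"
    and zero: "\<And>w. w \<in> ball z r \<Longrightarrow> cq_norm (F w - (c, 0)) = 0"
    and J: "J \<in> \<S>\<^sub>H" "slice_pt J z \<in> V" "f (slice_pt J z) = c" and nz: "snd (F z) \<noteq> 0"
  shows "\<exists>T. connected T \<and> T \<subseteq> {x \<in> \<Omega>. f x = c} \<and> slice_pt J z \<in> T \<and> (\<exists>x\<in>T. q0 x > q0 (slice_pt J z))"
proof -
  define j where "j = (\<lambda>w. - ((fst (F w) - c) * inverse (snd (F w))))"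
  have hol: "stem_holomorphic_on (ball z r) F" and V: "open V" using rep by (auto simp: stem_rep_def)
  have "z \<in> ball z r" using rep(2) by simp
  define W where "W = ball z r \<inter> F -` {w. snd w \<noteq> 0}"
  have "open {w :: cquat. snd w \<noteq> 0}" by (intro open_Collect_neq continuous_intros)
  then have "open W" unfolding W_def
    by (intro continuous_open_preimage[OF stem_holomorphic_continuous[OF hol]]) auto
  have cont: "continuous_on W (\<lambda>w. slice_pt (j w) w)"
    unfolding j_def by (rule root_path[OF hol]) (auto simp: W_def)
  then have "open (W \<inter> (\<lambda>w. slice_pt (j w) w) -` V)"
    using \<open>open W\<close> V by (rule continuous_open_preimage)
  moreover have "fst (F z) - c = - (J * snd (F z))"
    using stem_rep_zero(1)[OF rep(1) \<open>z \<in> ball z r\<close> J(1,2)] J(3) by (simp add: algebra_simps)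
  then have jz: "j z = J" using nz by (simp add: j_def mult.assoc)
  have "z \<in> W \<inter> (\<lambda>w. slice_pt (j w) w) -` V"
    using nz J(2) jz \<open>z \<in> ball z r\<close> by (simp add: W_def)
  ultimately obtain e where e: "e > 0" "ball z e \<subseteq> W \<inter> (\<lambda>w. slice_pt (j w) w) -` V"
    by (meson openE)
  \<comment> \<open>The root is followed over a horizontal segment to the right. It starts at
    \<open>slice_pt J z\<close> because \<open>j z = J\<close>.\<close>
  define T where "T = (\<lambda>t. slice_pt (j (z + of_real t)) (z + of_real t)) ` {0..e/2}"
  have inW: "z + of_real t \<in> W" "slice_pt (j (z + of_real t)) (z + of_real t) \<in> V" if "t \<in> {0..e/2}" for t
    using e of_real_shift_mem_ball[of t e z] that by auto
  have "continuous_on {0..e/2} (\<lambda>t. slice_pt (j (z + of_real t)) (z + of_real t))"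
    by (rule continuous_on_compose2[OF cont]) (use inW in \<open>auto intro!: continuous_intros\<close>)
  then have "connected T" unfolding T_def by (rule connected_continuous_image) simp
  moreover have "T \<subseteq> {x \<in> \<Omega>. f x = c}"
  proof
    fix x assume "x \<in> T"
    then obtain t where t: "t \<in> {0..e/2}" "x = slice_pt (j (z + of_real t)) (z + of_real t)" by (auto simp: T_def)
    have "z + of_real t \<in> ball z r" "snd (F (z + of_real t)) \<noteq> 0" using inW(1)[OF t(1)] by (auto simp: W_def)
    then have "f x = c"
      using root_value(2)[OF rep(1) _ _ zero, of "z + of_real t"] inW(2)[OF t(1)] t(2) by (simp add: j_def)
    then show "x \<in> {x \<in> \<Omega>. f x = c}" using inW(2)[OF t(1)] t(2) rep(3) by auto
  qed
  moreover have "slice_pt J z \<in> T"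
    unfolding T_def using e(1) jz by (intro image_eqI[of _ _ 0]) auto
  moreover have "\<exists>x\<in>T. q0 x > q0 (slice_pt J z)"
  proof
    show "slice_pt (j (z + of_real (e/2))) (z + of_real (e/2)) \<in> T"
      unfolding T_def using e(1) by (intro imageI) auto
    have "z + of_real (e/2) \<in> ball z r" "snd (F (z + of_real (e/2))) \<noteq> 0"
      using inW(1)[of "e/2"] e(1) by (auto simp: W_def)
    then have "j (z + of_real (e/2)) \<in> \<S>\<^sub>H"
      using root_value(1)[OF rep(1) _ _ zero] by (simp add: j_def)
    then show "q0 (slice_pt (j (z + of_real (e/2))) (z + of_real (e/2))) > q0 (slice_pt J z)"
      using imag_unitsD(1) J(1) e(1) by simp
  qed
  ultimately show ?thesis by blast
qed

text \<open>Over a degenerate sphere the root over \<open>z + t\<close> may be discontinuous at \<open>t = 0\<close>, but it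
  accumulates at some point of the sphere.\<close>

lemma no_rightmost_degenerate:
  assumes rep: "stem_rep f V (ball z r) F" "r > 0" "V \<subseteq> \<Omega>"
    and tube: "\<And>J w. J \<in> \<S>\<^sub>H \<Longrightarrow> w \<in> ball z r \<Longrightarrow> slice_pt J w \<in> V"
    and zero: "\<And>w. w \<in> ball z r \<Longrightarrow> cq_norm (F w - (c, 0)) = 0"
    and Fz: "F z = (c, 0)"
  shows "\<exists>T. connected T \<and> T \<subseteq> {x \<in> \<Omega>. f x = c} \<and> (\<exists>J\<in>\<S>\<^sub>H. slice_pt J z \<in> T) \<and> (\<exists>x\<in>T. q0 x > Re z)"
proof -
  have hol: "stem_holomorphic_on (ball z r) F" using rep by (auto simp: stem_rep_def)
  have zD: "z \<in> ball z r" using rep(2) by simp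
  \<comment> \<open>The complexified coordinates of \<open>F - c\<close>: if \<open>F\<close> is not
    constantly \<open>(c, 0)\<close>, one of them has an isolated zero at \<open>z\<close>, so
    \<open>F\<close> differs from \<open>(c, 0)\<close> on a punctured disc.\<close>
  define p where "p = (\<lambda>q :: quat \<Rightarrow> real. \<lambda>w. Complex (q (fst (F w - (c, 0)))) (q (snd (F w - (c, 0)))))"
  have p_hol: "p q holomorphic_on ball z r" if "bounded_linear q" for q
    unfolding p_def by (rule stem_component_holomorphic[OF open_ball stem_holomorphic_shift[OF hol] that])
  have p_eq: "F w = (c, 0)" if "p q0 w = 0" "p q1 w = 0" "p q2 w = 0" "p q3 w = 0" for w
    using that by (simp add: p_def complex_eq_iff prod_eq_iff quat_eq_iff)
  show ?thesis
  proof (cases "\<forall>w\<in>ball z r. F w = (c, 0)")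
    case True
    define T where "T = (\<lambda>t. slice_pt qi (z + of_real t)) ` {0..r/2}"
    have D: "z + of_real t \<in> ball z r" if "t \<in> {0..r/2}" for t
      using of_real_shift_mem_ball[of t r z] that rep(2) by auto
    have "connected T" unfolding T_def
      by (rule connected_continuous_image) (unfold slice_pt_def, auto intro!: continuous_intros)
    moreover have "f (slice_pt qi w) = c" if "w \<in> ball z r" for w
      using stem_rep_zero(1)[OF rep(1) that qi_imag_unit tube[OF qi_imag_unit that]] True that by simp
    then have "T \<subseteq> {x \<in> \<Omega>. f x = c}"
      unfolding T_def using D tube[OF qi_imag_unit] rep(3) by blast
    moreover have "slice_pt qi z \<in> T"
      unfolding T_def using rep(2) by (intro image_eqI[of _ _ 0]) auto
    moreover have "\<exists>x\<in>T. q0 x > Re z"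
      using rep(2) imag_unitsD(1)[OF qi_imag_unit] by (auto simp: T_def intro!: bexI[of _ "r/2"])
    ultimately show ?thesis using qi_imag_unit by blast
  next
    case False
    then obtain w where w: "w \<in> ball z r" "F w \<noteq> (c, 0)" by blast
    then obtain q where q: "bounded_linear q" "p q w \<noteq> 0"
      using p_eq bounded_linear_qsel by blast
    interpret q: bounded_linear q by (rule q(1))
    have "p q z = 0" by (simp add: p_def Fz q.zero complex_eq_iff)
    then obtain e where e: "e > 0" "ball z e \<subseteq> ball z r" "\<And>w. w \<in> ball z e - {z} \<Longrightarrow> p q w \<noteq> 0"
      using isolated_zeros[OF p_hol[OF q(1)] open_ball connected_ball zD _ w(1) q(2)] by blast
    define j where "j = (\<lambda>w. - ((fst (F w) - c) * inverse (snd (F w))))"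
    have D: "z + of_real t \<in> ball z r" "snd (F (z + of_real t)) \<noteq> 0" if t: "t \<in> {0<..<e}" for t
    proof -
      have te: "z + of_real t \<in> ball z e - {z}" using of_real_shift_mem_ball[of t e z] t by auto
      then show D: "z + of_real t \<in> ball z r" using e(2) by blast
      have "F (z + of_real t) \<noteq> (c, 0)"
        using e(3)[OF te] by (auto simp: p_def q.zero complex_eq_iff)
      \<comment> \<open>If the norm form vanishes, a zero second component would force the first one
        to be \<open>c\<close>.\<close>
      then show "snd (F (z + of_real t)) \<noteq> 0"
        using zero[OF D] by (auto simp: cq_norm_eq_0_iff prod_eq_iff)
    qed
    have j: "j (z + of_real t) \<in> \<S>\<^sub>H" "f (slice_pt (j (z + of_real t)) (z + of_real t)) = c"
      if t: "t \<in> {0<..<e}" for t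
      using root_value[OF rep(1) D[OF t] zero[OF D(1)[OF t]]] tube D[OF t] by (auto simp: j_def)
    define T where "T = (\<lambda>t. slice_pt (j (z + of_real t)) (z + of_real t)) ` {0<..<e}"
    have "continuous_on {w \<in> ball z r. snd (F w) \<noteq> 0} (\<lambda>w. slice_pt (j w) w)"
      unfolding j_def by (rule root_path[OF hol]) auto
    then have "continuous_on {0<..<e} (\<lambda>t. slice_pt (j (z + of_real t)) (z + of_real t))"
      by (rule continuous_on_compose2) (use D in \<open>auto intro!: continuous_intros\<close>)
    then have T: "connected T" unfolding T_def by (rule connected_continuous_image) simp
    \<comment> \<open>The offset 2 keeps every \<open>t n\<close> strictly below \<open>e\<close>,
      including the first.\<close>
    define t where "t = (\<lambda>n. e / (real n + 2))"
    have t: "t n \<in> {0<..<e}" for n using e(1) by (auto simp: t_def field_simps add_pos_nonneg)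
    have "t \<longlonglongrightarrow> 0" unfolding t_def by real_asymp
    have "\<forall>n. j (z + of_real (t n)) \<in> \<S>\<^sub>H" using j(1) t by blast
    then obtain J s where J: "J \<in> \<S>\<^sub>H" "strict_mono s" "((\<lambda>n. j (z + of_real (t n))) \<circ> s) \<longlonglongrightarrow> J"
      using compact_imag_units unfolding compact_def by metis
    have "(\<lambda>n. z + of_real (t (s n))) \<longlonglongrightarrow> z + of_real 0"
      by (intro tendsto_intros LIMSEQ_subseq_LIMSEQ[OF \<open>t \<longlonglongrightarrow> 0\<close> J(2), unfolded o_def])
    then have lim: "(\<lambda>n. z + of_real (t (s n))) \<longlonglongrightarrow> z" by simp
    have "(\<lambda>n. slice_pt (j (z + of_real (t (s n)))) (z + of_real (t (s n)))) \<longlonglongrightarrow> slice_pt J z"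
      unfolding slice_pt_def by (intro tendsto_intros lim J(3)[unfolded o_def])
    moreover have "slice_pt (j (z + of_real (t (s n)))) (z + of_real (t (s n))) \<in> T" for n
      unfolding T_def using t by blast
    ultimately have "slice_pt J z \<in> closure T" unfolding closure_sequential
      by (intro exI[of _ "\<lambda>n. slice_pt (j (z + of_real (t (s n)))) (z + of_real (t (s n)))"]) simp
    \<comment> \<open>Adding a limit point of the open path keeps it connected and makes it reach
      the sphere over \<open>z\<close>.\<close>
    then have "connected (insert (slice_pt J z) T)"
      by (intro connected_intermediate_closure[OF T]) (auto simp: closure_subset[THEN subsetD])
    moreover have "f (slice_pt J z) = c"
      using stem_rep_zero(1)[OF rep(1) zD J(1) tube[OF J(1) zD]] Fz by simp
    then have "insert (slice_pt J z) T \<subseteq> {x \<in> \<Omega>. f x = c}"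
      unfolding T_def using j D tube[OF J(1) zD] tube rep(3) by blast
    moreover have "\<exists>x\<in>T. q0 x > Re z"
      using t[of 0] j(1)[OF t[of 0]] imag_unitsD(1)
      by (auto simp: T_def intro!: bexI[of _ "t 0"])
    ultimately show ?thesis using J(1) by blast
  qed
qed

text \<open>Over real \<open>z\<close> the second stem component is zero, so a vanishing norm form
  puts a whole segment of the real axis into the fibre.\<close>

lemma no_rightmost_real:
  assumes rep: "stem_rep f V (ball z r) F" "r > 0" "V \<subseteq> \<Omega>" "J \<in> \<S>\<^sub>H"
    and V: "\<And>w. w \<in> ball z r \<Longrightarrow> slice_pt J w \<in> V"
    and zero: "\<And>w. w \<in> ball z r \<Longrightarrow> cq_norm (F w - (c, 0)) = 0"
    and z: "Im z = 0"
  shows "\<exists>T. connected T \<and> T \<subseteq> {x \<in> \<Omega>. f x = c} \<and> slice_pt J z \<in> T \<and> (\<exists>x\<in>T. q0 x > q0 (slice_pt J z))"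
proof -
  define T where "T = (\<lambda>t. slice_pt J (z + of_real t)) ` {0..r/2}"
  have "connected T" unfolding T_def
    by (rule connected_continuous_image) (unfold slice_pt_def, auto intro!: continuous_intros)
  moreover have "T \<subseteq> {x \<in> \<Omega>. f x = c}"
  proof
    fix x assume "x \<in> T"
    then obtain t where t: "t \<in> {0..r/2}" "x = slice_pt J (z + of_real t)" by (auto simp: T_def)
    let ?w = "z + of_real t"
    have w: "?w \<in> ball z r" using of_real_shift_mem_ball[of t r z] t(1) rep(2) by auto
    have "snd (F ?w) = 0" using stem_rep_zero(2)[OF rep(1) w rep(4) V[OF w]] z by simp
    moreover have "fst (F ?w) = c" using zero[OF w] calculation by (simp add: cq_norm_eq_0_iff)
    ultimately have "f x = c" using stem_rep_zero(1)[OF rep(1) w rep(4) V[OF w]] t(2) by simp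
    then show "x \<in> {x \<in> \<Omega>. f x = c}" using V[OF w] t(2) rep(3) by auto
  qed
  moreover have "slice_pt J z \<in> T"
    unfolding T_def using rep(2) by (intro image_eqI[of _ _ 0]) auto
  moreover have "\<exists>x\<in>T. q0 x > q0 (slice_pt J z)"
    using rep(2) imag_unitsD(1)[OF rep(4)] by (auto simp: T_def intro!: bexI[of _ "r/2"])
  ultimately show ?thesis by blast
qed

text \<open>If the conclusion fails, the openness lemmas force the norm form to vanish identically
  near the rightmost point \<open>x\<close>. Each case then yields a connected part of the fibre
  that meets \<open>C\<close> and reaches further right, against \<open>maximal\<close>.\<close>

lemma interior_image_of_compact_component:
  assumes \<Omega>: "open \<Omega>" "f \<in> SR_loc \<Omega>" and C: "compact C" "C \<noteq> {}" "C \<subseteq> {x \<in> \<Omega>. f x = c}"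
    and maximal: "\<And>T. connected T \<Longrightarrow> T \<subseteq> {x \<in> \<Omega>. f x = c} \<Longrightarrow> T \<inter> C \<noteq> {} \<Longrightarrow> T \<subseteq> C"
    and U: "open U" "C \<subseteq> U"
  shows "c \<in> interior (f ` U)"
proof (rule ccontr)
  assume not: "c \<notin> interior (f ` U)"
  obtain x where x: "x \<in> C" "\<And>y. y \<in> C \<Longrightarrow> q0 y \<le> q0 x"
    using continuous_attains_sup[OF C(1,2) continuous_on_qsel(1)] by blast
  have contra: False
    if "connected T" "T \<subseteq> {x \<in> \<Omega>. f x = c}" "T \<inter> C \<noteq> {}" "\<exists>y\<in>T. q0 y > q0 x" for T
    using maximal[OF that(1-3)] that(4) x(2) by force
  have x': "x \<in> \<Omega>" "f x = c" "x \<in> U" using x(1) C(3) U(2) by auto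
  define J z where "J = slice_unit x" and "z = slice_coord x"
  have J: "J \<in> \<S>\<^sub>H" and xz: "slice_pt J z = x"
    by (simp_all add: J_def z_def slice_unit_in_imag_units slice_pt_unit_coord)
  obtain r F where r: "r > 0" "ball x r \<subseteq> \<Omega>" "Im z = 0 \<or> r \<le> Im z"
    and rep: "stem_rep f (ball x r) (ball z r) F"
    by (rule good_ball[OF \<Omega> x'(1)]) (auto simp: z_def)
  have zr: "z \<in> ball z r" using r(1) by simp
  consider "Im z = 0" | "Im z > 0" "snd (F z) \<noteq> 0" | "Im z > 0" "snd (F z) = 0"
    using Im_slice_coord_nonneg[of x] by (force simp: z_def)
  then show False
  proof cases
    case 1
    then have "slice_pt K z = x" for K using xz by (simp add: slice_pt_real)
    then have zero: "cq_norm (F w - (c, 0)) = 0" if "w \<in> ball z r" for w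
      using stem_rep_open_at_sphere[OF rep connected_ball zr that, of c U J] not J x' r(1) U(1) by auto
    have "slice_pt J w \<in> ball x r" if "w \<in> ball z r" for w
      unfolding J_def using slice_pt_mem_ball that by (simp add: z_def)
    from no_rightmost_real[OF rep r(1,2) J this zero 1] show False
      using contra x(1) xz by blast
  next
    case 2
    then have zero: "cq_norm (F w - (c, 0)) = 0" if "w \<in> ball z r" for w
      using stem_rep_open_at[OF rep connected_ball zr that, of c J U] not J x' r(1) U(1) xz by auto
    have "slice_pt J z \<in> ball x r" "f (slice_pt J z) = c" using xz r(1) x'(2) by simp_all
    from no_rightmost_nondegenerate[OF rep r(1,2) zero J this 2(2)] show False
      using contra x(1) xz by blast
  next
    case 3
    \<comment> \<open>The whole sphere of \<open>x\<close> lies in \<open>C\<close>, so the ball is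
      replaced by a tube about that sphere.\<close>
    have "dbar f x = 0"
      using stem_rep_zero(2)[OF rep zr J] 3 xz r(1) by simp
    then have sphere: "slice_pt K z \<in> C" if "K \<in> \<S>\<^sub>H" for K
      using degenerate_sphere_subset[OF \<Omega> C(1,3) maximal x(1)] 3(1) that by (simp add: z_def)
    then have "slice_pt K z \<in> \<Omega>" if "K \<in> \<S>\<^sub>H" for K using C(3) that by blast
    then obtain e where e: "e > 0" "\<And>K w. K \<in> \<S>\<^sub>H \<Longrightarrow> w \<in> ball z e \<Longrightarrow> slice_pt K w \<in> \<Omega>"
      using sphere_tube[OF \<Omega>(1)] by metis
    \<comment> \<open>The bound by \<open>Im z\<close> keeps the disc in the open upper half-plane,
      as \<open>stem_rep_tube\<close> requires.\<close>
    define d V where "d = min e (Im z)" and "V = slice_coord -` ball z d"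
    have d: "d > 0" "d \<le> e" "d \<le> Im z" using e(1) 3(1) by (auto simp: d_def)
    have sub: "ball z d \<subseteq> ball z e" using d(2) by auto
    obtain G where G: "stem_rep f V (ball z d) G"
      unfolding V_def using stem_rep_tube[OF \<Omega> d(3)] e(2) sub by blast
    have tube: "slice_pt K w \<in> V" if "K \<in> \<S>\<^sub>H" "w \<in> ball z d" for K w
    proof -
      have "\<bar>Im z - Im w\<bar> < d"
        using that(2) abs_Im_le_cmod[of "z - w"] by (simp add: dist_norm)
      then have "Im w \<ge> 0" using d(3) by linarith
      then show ?thesis using that by (simp add: V_def slice_coord_slice_pt)
    qed
    have V\<Omega>: "V \<subseteq> \<Omega>"
    proof
      fix y assume "y \<in> V"
      then have "slice_pt (slice_unit y) (slice_coord y) \<in> \<Omega>" using sub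
        by (intro e(2) slice_unit_in_imag_units) (auto simp: V_def)
      then show "y \<in> \<Omega>" by (simp add: slice_pt_unit_coord)
    qed
    have zd: "z \<in> ball z d" using d(1) by simp
    have zero: "cq_norm (G w - (c, 0)) = 0" if "w \<in> ball z d" for w
      using stem_rep_open_at_sphere[OF G connected_ball zd that, of c U J] not J x'(2) xz U tube zd sphere by auto
    have "snd (G z) = 0"
      using stem_rep_zero(2)[OF G zd J tube[OF J zd]] \<open>dbar f x = 0\<close> xz by simp
    moreover have "fst (G z) = c"
      using stem_rep_zero(1)[OF G zd J tube[OF J zd]] calculation xz x'(2) by simp
    ultimately have "G z = (c, 0)" by (simp add: prod_eq_iff)
    from no_rightmost_degenerate[OF G d(1) V\<Omega> tube zero this]
    obtain T where T: "connected T" "T \<subseteq> {x \<in> \<Omega>. f x = c}" "\<exists>K\<in>\<S>\<^sub>H. slice_pt K z \<in> T" "\<exists>y\<in>T. q0 y > Re z"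
      by blast
    have "q0 x = Re z" by (simp add: z_def slice_coord_def)
    then show False using contra[OF T(1,2)] T(3,4) sphere by auto
  qed
qed

lemma quasi_open_map_SR_loc:
  assumes "open \<Omega>" "f \<in> SR_loc \<Omega>"
  shows "quasi_open_map (top_of_set \<Omega>) euclidean f"
  unfolding quasi_open_map_def
proof (intro conjI ballI allI impI)
  show "continuous_map (top_of_set \<Omega>) euclidean f"
    using SR_loc_continuous_on[OF assms(2)] by simp
  fix c U
  let ?A = "{x \<in> \<Omega>. f x = c}"
  assume *: "openin (top_of_set \<Omega>) U \<and> (\<exists>C\<in>connected_components_of
    (subtopology (top_of_set \<Omega>) {x \<in> topspace (top_of_set \<Omega>). f x = c}). compactin (top_of_set \<Omega>) C \<and> C \<subseteq> U)"
  \<comment> \<open>Components in the iterated subspace are those of the fibre as a subset of the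
    quaternions.\<close>
  have "subtopology (top_of_set \<Omega>) {x \<in> topspace (top_of_set \<Omega>). f x = c} = top_of_set ?A"
    unfolding subtopology_subtopology by (rule arg_cong[of _ _ top_of_set]) auto
  with * obtain C where C: "C \<in> connected_components_of (top_of_set ?A)" "compactin (top_of_set \<Omega>) C" "C \<subseteq> U"
    by auto
  have "open U" using * assms(1) openin_open_eq by blast
  have "c \<in> interior (f ` U)"
  proof (rule interior_image_of_compact_component[OF assms])
    show "compact C" using C(2) by (simp add: compactin_subtopology)
    show "C \<noteq> {}" using nonempty_connected_components_of[OF C(1)] .
    show "C \<subseteq> ?A" using connected_components_of_subset[OF C(1)] by simp
    show "T \<subseteq> C" if "connected T" "T \<subseteq> ?A" "T \<inter> C \<noteq> {}" for T
      using connected_components_of_maximal[OF C(1), of T] that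
      by (auto simp: connectedin_subtopology disjnt_def)
    show "open U" "C \<subseteq> U" by fact+
  qed
  then show "c \<in> euclidean interior_of (f ` U)" by simp
qed

theorem theorem23:
  fixes \<Omega> :: "quat set" and f :: "quat \<Rightarrow> quat"
  assumes "open \<Omega>" and "f \<in> SR_loc \<Omega> - SC_loc \<Omega>"
  shows "quasi_open_map (top_of_set \<Omega>) euclidean f \<and>
         open_map (top_of_set (\<Omega> - (degenerate_set \<Omega> f \<union> wing_set \<Omega> f))) euclidean f"
  using assms quasi_open_map_SR_loc open_map_regular_points by blast

end
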